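(* Let $\mathbf{X}$ be a finite set with $n = |\mathbf{X}| \ge 2$, let $\pi$ be a monotone linkage function on $\mathbf{X}$ each value of which can be computed by a single processor in time $g \ge 1$, and let $M_\pi(\mathbf{T}) = \min_{y \in \mathbf{X}\setminus\mathbf{T}} \pi(y,\mathbf{T})$ for $\mathbf{T} \in \mathcal{P}^{-\mathbf{X}} = 2^{\mathbf{X}}\setminus\{\varnothing,\mathbf{X}\}$. There is a parallel algorithm (in the concurrent-read concurrent-write model) that finds all inclusion-minimal maximizers of $M_\pi$ over $\mathcal{P}^{-\mathbf{X}}$ and runs in time (i) $\mathcal{O}(n^2 g) + \mathcal{O}(\log\log n)$ on $n$ processors; (ii) $\mathcal{O}(g\, n \log n)$ on $n^2$ processors; (iii) $\mathcal{O}(g\, n)$ on $n^3$ processors.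
   Context: A monotone linkage function on $\mathbf{X}$ is a real-valued function $\pi(y,\mathbf{Z})$, defined for $\mathbf{Z} \in \mathcal{P}^{-\mathbf{X}}$ and $y \in \mathbf{X}\setminus\mathbf{Z}$, such that $\pi(y,\mathbf{S}) \ge \pi(y,\mathbf{T})$ whenever $\mathbf{S} \subseteq \mathbf{T}$ are in $\mathcal{P}^{-\mathbf{X}}$ and $y \in \mathbf{X}\setminus\mathbf{T}$. A maximizer of $M_\pi$ over $\mathcal{P}^{-\mathbf{X}}$ is a set $\mathbf{S}\in\mathcal{P}^{-\mathbf{X}}$ with $M_\pi(\mathbf{S}) = \max_{\mathbf{T} \in \mathcal{P}^{-\mathbf{X}}} M_\pi(\mathbf{T})$; it is inclusion-minimal if no proper subset of it belonging to $\mathcal{P}^{-\mathbf{X}}$ is a maximizer. The model of computation is the parallel random access machine with concurrent reads and concurrent writes (CRCW PRAM); comparisons of real numbers and elementary operations take unit time, and one evaluation of $\pi$ takes time $g$ on one processor. *)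

theory Defs
  imports Complex_Main
begin

section \<open>Monotone linkage functions\<close>

definition proper_subsets :: "'a set \<Rightarrow> 'a set set" where
  "proper_subsets X = Pow X - {{}, X}"

text \<open>
  A linkage function is a total HOL function; only its values \<open>\<pi> y Z\<close> with
  \<open>Z \<in> proper_subsets X\<close> and \<open>y \<in> X - Z\<close> are constrained.
\<close>

definition monotone_linkage :: "'a set \<Rightarrow> ('a \<Rightarrow> 'a set \<Rightarrow> real) \<Rightarrow> bool" where
  "monotone_linkage X \<pi> \<longleftrightarrow>
     (\<forall>S\<in>proper_subsets X. \<forall>T\<in>proper_subsets X. \<forall>y\<in>X - T. S \<subseteq> T \<longrightarrow> \<pi> y S \<ge> \<pi> y T)"

definition linkage_min :: "'a set \<Rightarrow> ('a \<Rightarrow> 'a set \<Rightarrow> real) \<Rightarrow> 'a set \<Rightarrow> real" where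
  "linkage_min X \<pi> T = Min ((\<lambda>y. \<pi> y T) ` (X - T))"

definition maximizers :: "'a set \<Rightarrow> ('a \<Rightarrow> 'a set \<Rightarrow> real) \<Rightarrow> 'a set set" where
  "maximizers X \<pi> = {S \<in> proper_subsets X.
     linkage_min X \<pi> S = Max (linkage_min X \<pi> ` proper_subsets X)}"

definition minimal_maximizers :: "'a set \<Rightarrow> ('a \<Rightarrow> 'a set \<Rightarrow> real) \<Rightarrow> 'a set set" where
  "minimal_maximizers X \<pi> = {S \<in> maximizers X \<pi>.
     \<not> (\<exists>S'\<in>proper_subsets X. S' \<subset> S \<and> S' \<in> maximizers X \<pi>)}"


section \<open>A CRCW PRAM with a linkage oracle\<close>

text \<open>
  Every processor has its own program counter and two banks of registers, for natural numbers
  and for reals; the shared memory consists of two corresponding banks of cells. All processors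
  run the same program. Register names are fixed in the program text, so a program uses boundedly
  many registers per processor. The arithmetic is that of Fortune and Wyllie's PRAM (addition and
  truncated subtraction, no unit-cost multiplication); reals can be copied and compared.
\<close>

datatype instr =
    Const nat nat          \<comment> \<open>\<open>Const d k\<close>: \<open>d := k\<close>\<close>
  | Move nat nat           \<comment> \<open>\<open>Move d s\<close>: \<open>d := s\<close>\<close>
  | Add nat nat nat
  | Sub nat nat nat
  | Less nat nat nat       \<comment> \<open>\<open>Less d s t\<close>: \<open>d := 1\<close> if \<open>s < t\<close>, else \<open>d := 0\<close>\<close>
  | CMove nat nat nat      \<comment> \<open>\<open>CMove b d s\<close>: \<open>d := s\<close> if \<open>b\<close> is nonzero\<close>
  | Load nat nat           \<comment> \<open>\<open>Load d a\<close>: \<open>d := M[a]\<close>\<close>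
  | Store nat nat          \<comment> \<open>\<open>Store a s\<close>: \<open>M[a] := s\<close>\<close>
  | MoveR nat nat
  | LessR nat nat nat      \<comment> \<open>compares two real registers; the result is a natural number\<close>
  | CMoveR nat nat nat
  | LoadR nat nat
  | StoreR nat nat
  | Jump nat
  | JumpZero nat nat       \<comment> \<open>\<open>JumpZero b l\<close>: go to \<open>l\<close> if \<open>b\<close> is zero\<close>
  | Eval nat nat nat       \<comment> \<open>\<open>Eval d y z\<close>: see \<open>exec\<close> below\<close>

record processor =
  pc :: nat
  reg :: "nat \<Rightarrow> nat"
  rreg :: "nat \<Rightarrow> real"

record config =
  procs :: "nat \<Rightarrow> processor"
  mem :: "nat \<Rightarrow> nat"
  rmem :: "nat \<Rightarrow> real"

definition set_reg :: "nat \<Rightarrow> nat \<Rightarrow> processor \<Rightarrow> processor" where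
  "set_reg d v P = P\<lparr>pc := Suc (pc P), reg := (reg P)(d := v)\<rparr>"

definition set_rreg :: "nat \<Rightarrow> real \<Rightarrow> processor \<Rightarrow> processor" where
  "set_rreg d v P = P\<lparr>pc := Suc (pc P), rreg := (rreg P)(d := v)\<rparr>"

definition goto :: "nat \<Rightarrow> processor \<Rightarrow> processor" where
  "goto l P = P\<lparr>pc := l\<rparr>"

definition decode_set :: "nat \<Rightarrow> (nat \<Rightarrow> nat) \<Rightarrow> nat \<Rightarrow> nat set" where
  "decode_set n M a = {i. i < n \<and> M (a + i) \<noteq> 0}"

text \<open>
  The ground set of size \<open>n\<close> is presented to the machine as \<open>{..<n}\<close>. The instruction \<open>Eval d y z\<close>
  calls the oracle \<open>orc\<close> for the element in register \<open>y\<close> and the set whose characteristic vector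
  occupies the \<open>n\<close> shared cells starting at the address in register \<open>z\<close>.
\<close>

fun exec :: "(nat \<Rightarrow> nat set \<Rightarrow> real) \<Rightarrow> nat \<Rightarrow> (nat \<Rightarrow> nat) \<Rightarrow> (nat \<Rightarrow> real) \<Rightarrow>
    instr \<Rightarrow> processor \<Rightarrow> processor" where
  "exec orc n M R (Const d k) P = set_reg d k P"
| "exec orc n M R (Move d s) P = set_reg d (reg P s) P"
| "exec orc n M R (Add d s t) P = set_reg d (reg P s + reg P t) P"
| "exec orc n M R (Sub d s t) P = set_reg d (reg P s - reg P t) P"
| "exec orc n M R (Less d s t) P = set_reg d (if reg P s < reg P t then 1 else 0) P"
| "exec orc n M R (CMove b d s) P = set_reg d (if reg P b \<noteq> 0 then reg P s else reg P d) P"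
| "exec orc n M R (Load d a) P = set_reg d (M (reg P a)) P"
| "exec orc n M R (Store a s) P = goto (Suc (pc P)) P"
| "exec orc n M R (MoveR d s) P = set_rreg d (rreg P s) P"
| "exec orc n M R (LessR d s t) P = set_reg d (if rreg P s < rreg P t then 1 else 0) P"
| "exec orc n M R (CMoveR b d s) P = set_rreg d (if reg P b \<noteq> 0 then rreg P s else rreg P d) P"
| "exec orc n M R (LoadR d a) P = set_rreg d (R (reg P a)) P"
| "exec orc n M R (StoreR a s) P = goto (Suc (pc P)) P"
| "exec orc n M R (Jump l) P = goto l P"
| "exec orc n M R (JumpZero b l) P = goto (if reg P b = 0 then l else Suc (pc P)) P"
| "exec orc n M R (Eval d y z) P = set_rreg d (orc (reg P y) (decode_set n M (reg P z))) P"

definition fetch :: "instr list \<Rightarrow> processor \<Rightarrow> instr option" where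
  "fetch prog P = (if pc P < length prog then Some (prog ! pc P) else None)"

definition writes :: "instr list \<Rightarrow> nat \<Rightarrow> config \<Rightarrow> nat \<Rightarrow> nat set" where
  "writes prog p c a = {v. \<exists>i<p. \<exists>r s. fetch prog (procs c i) = Some (Store r s) \<and>
     reg (procs c i) r = a \<and> reg (procs c i) s = v}"

definition rwrites :: "instr list \<Rightarrow> nat \<Rightarrow> config \<Rightarrow> nat \<Rightarrow> real set" where
  "rwrites prog p c a = {v. \<exists>i<p. \<exists>r s. fetch prog (procs c i) = Some (StoreR r s) \<and>
     reg (procs c i) r = a \<and> rreg (procs c i) s = v}"

text \<open>
  A synchronous step of \<open>p\<close> processors: all reads see the memory before the step. Concurrent writes
  follow the ARBITRARY convention: one of the values written to a cell succeeds, and a program has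
  no influence on which. A processor whose program counter has left the program stays put.
\<close>

definition step :: "instr list \<Rightarrow> nat \<Rightarrow> (nat \<Rightarrow> nat set \<Rightarrow> real) \<Rightarrow> nat \<Rightarrow> config \<Rightarrow> config \<Rightarrow> bool" where
  "step prog n orc p c c' \<longleftrightarrow>
     (\<forall>i<p. procs c' i =
        (case fetch prog (procs c i) of
           None \<Rightarrow> procs c i
         | Some ins \<Rightarrow> exec orc n (mem c) (rmem c) ins (procs c i))) \<and>
     (\<forall>a. mem c' a \<in> (if writes prog p c a = {} then {mem c a} else writes prog p c a)) \<and>
     (\<forall>a. rmem c' a \<in> (if rwrites prog p c a = {} then {rmem c a} else rwrites prog p c a))"

definition initial :: "nat \<Rightarrow> nat \<Rightarrow> config" where
  "initial n p =
     \<lparr>procs = (\<lambda>i. \<lparr>pc = 0, reg = (\<lambda>_. 0)(0 := i, 1 := n, 2 := p), rreg = (\<lambda>_. 0)\<rparr>),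
      mem = (\<lambda>_. 0), rmem = (\<lambda>_. 0)\<rparr>"

definition is_run :: "instr list \<Rightarrow> nat \<Rightarrow> (nat \<Rightarrow> nat set \<Rightarrow> real) \<Rightarrow> nat \<Rightarrow> (nat \<Rightarrow> config) \<Rightarrow> bool" where
  "is_run prog n orc p c \<longleftrightarrow> c 0 = initial n p \<and> (\<forall>t. step prog n orc p (c t) (c (Suc t)))"

definition halted :: "instr list \<Rightarrow> nat \<Rightarrow> config \<Rightarrow> bool" where
  "halted prog p c \<longleftrightarrow> (\<forall>i<p. fetch prog (procs c i) = None)"

text \<open>
  A step takes unit time, or time \<open>g\<close> if at least one processor evaluates the linkage function in
  it; the processors that do not evaluate then wait for those that do.
\<close>

definition step_time :: "instr list \<Rightarrow> nat \<Rightarrow> real \<Rightarrow> config \<Rightarrow> real" where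
  "step_time prog p g c =
     (if \<exists>i<p. \<exists>d y z. fetch prog (procs c i) = Some (Eval d y z) then g else 1)"

definition elapsed :: "instr list \<Rightarrow> nat \<Rightarrow> real \<Rightarrow> (nat \<Rightarrow> config) \<Rightarrow> nat \<Rightarrow> real" where
  "elapsed prog p g c t = (\<Sum>s<t. step_time prog p g (c s))"

text \<open>
  Output convention: cell \<open>0\<close> holds the number of sets found, followed by their characteristic
  vectors.
\<close>

definition output_sets :: "nat \<Rightarrow> (nat \<Rightarrow> nat) \<Rightarrow> nat set list" where
  "output_sets n M = map (\<lambda>k. decode_set n M (1 + k * n)) [0..<M 0]"

text \<open>
  The elements of \<open>X\<close> may be numbered in any way \<open>xs\<close>. On \<open>p\<close> processors, with evaluations of
  \<open>\<pi>\<close> taking time \<open>g\<close>, every run must halt within time \<open>T\<close> with the minimal maximizers listed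
  without repetition.
\<close>

definition finds_minimal_maximizers ::
    "instr list \<Rightarrow> nat \<Rightarrow> 'a set \<Rightarrow> ('a \<Rightarrow> 'a set \<Rightarrow> real) \<Rightarrow> real \<Rightarrow> real \<Rightarrow> bool" where
  "finds_minimal_maximizers prog p X \<pi> g T \<longleftrightarrow>
     (\<forall>xs c. distinct xs \<and> set xs = X \<and>
        is_run prog (card X) (\<lambda>i Z. \<pi> (xs ! i) ((!) xs ` Z)) p c \<longrightarrow>
        (\<exists>t. halted prog p (c t) \<and> elapsed prog p g c t \<le> T \<and>
           (let found = map ((`) ((!) xs)) (output_sets (card X) (mem (c t)))
            in distinct found \<and> set found = minimal_maximizers X \<pi>)))"

end

theory Submission
  imports Defs
begin

text \<open>
  Fix an element \<open>i\<close> and grow a chain from \<open>{i}\<close>, always adding an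
  element \<open>y\<close> outside the current set \<open>S\<close> with \<open>\<pi> y S\<close>
  least. Write \<open>M S\<close> for this least value. If \<open>i \<in> T\<close> and
  \<open>T\<close> is proper, let \<open>S\<close> be the last member of the chain inside
  \<open>T\<close> and \<open>y \<notin> T\<close> the element added next. Monotonicity gives
  \<open>M T \<le> \<pi> y T \<le> \<pi> y S = M S\<close>. So the best value on the chain is the
  best value among all proper sets containing \<open>i\<close>, and the first member \<open>A
  i\<close> of the chain that attains it lies inside every such set attaining it
  (\<open>greedy_inv_least_best\<close>). The minimal maximizers are therefore among the sets
  \<open>A i\<close>, and membership tests between the sets \<open>A i\<close> decide which of
  them are minimal and which index represents each of them
  (\<open>minimal_maximizers_rep\<close>).

  All \<open>n\<close> chains are grown simultaneously, in \<open>n - 1\<close> rounds; a round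
  needs \<open>n\<close> evaluations and one minimum per chain. With one processor per chain both
  are done sequentially in \<open>O(n)\<close> steps. With \<open>n\<close> processors per chain
  one parallel evaluation is followed by \<open>O(log n)\<close> steps of pointer doubling. With
  \<open>n^2\<close> processors per chain every pair of candidates is compared at once, the losers
  are flagged, and one of the remaining candidates is picked by a concurrent write, in
  \<open>O(1)\<close> steps. Everything before and after the rounds takes \<open>O(n)\<close>
  steps even on \<open>n\<close> processors. Because \<open>g \<ge> 1\<close>, a step takes at
  most time \<open>g\<close> (\<open>elapsed_le\<close>), and only steps have to be counted.

  A single program does all this; the number of processors only determines four parameters of it.
  Each round is a sequential scan of \<open>len\<close> candidates, a doubling phase of width
  \<open>w\<close> and an all-pairs comparison on an \<open>a\<close> by \<open>b\<close> grid of
  processors, and for each number of processors the parameters make some of these phases trivial.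
  Its correctness (\<open>whole_hoare\<close>) rests on the fact that all processors always share
  one program counter: a processor that should stay idle writes into cell \<open>0\<close>, which
  is not read before the end. This turns the machine into one that operates on vectors of
  registers and admits an ordinary Hoare logic with step counts.
\<close>


section \<open>Lockstep programs and their correctness\<close>

text \<open>
  Registers are viewed as vectors over the processors: in an assertion \<open>P V W M N\<close>, \<open>V r q\<close> and
  \<open>W r q\<close> are the natural and the real register \<open>r\<close> of processor \<open>q\<close>, and \<open>M\<close> and \<open>N\<close> are the two
  banks of the memory.
\<close>

type_synonym assn =
  "(nat \<Rightarrow> nat \<Rightarrow> nat) \<Rightarrow> (nat \<Rightarrow> nat \<Rightarrow> real) \<Rightarrow> (nat \<Rightarrow> nat) \<Rightarrow> (nat \<Rightarrow> real) \<Rightarrow> bool"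

text \<open>
  \<open>While x y C\<close> runs \<open>C\<close> as long as register \<open>x\<close> is below register \<open>y\<close>. The outcome of the test is
  kept in register \<open>3\<close>, which is reserved for this purpose, and has to be the same on all processors.
\<close>

datatype com =
    Block "instr list"
  | Seq com com  (infixr \<open>;;\<close> 60)
  | While nat nat com

fun csize :: "com \<Rightarrow> nat" where
  "csize (Block is) = length is"
| "csize (C ;; D) = csize C + csize D"
| "csize (While x y C) = csize C + 3"

fun compile :: "nat \<Rightarrow> com \<Rightarrow> instr list" where
  "compile l (Block is) = is"
| "compile l (C ;; D) = compile l C @ compile (l + csize C) D"
| "compile l (While x y C) =
     [Less 3 x y, JumpZero 3 (l + csize C + 3)] @ compile (l + 2) C @ [Jump l]"

lemma length_compile [simp]: "length (compile l C) = csize C"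
  by (induction C arbitrary: l) auto

text \<open>
  One resolution of concurrent writes under the ARBITRARY convention: processor \<open>q\<close> writes \<open>v q\<close> to
  address \<open>A q\<close>, and \<open>M'\<close> is a possible memory afterwards.
\<close>

definition outcome :: "nat \<Rightarrow> (nat \<Rightarrow> nat) \<Rightarrow> (nat \<Rightarrow> 'v) \<Rightarrow> (nat \<Rightarrow> 'v) \<Rightarrow> (nat \<Rightarrow> 'v) \<Rightarrow> bool" where
  "outcome p A v M M' \<longleftrightarrow>
     (\<forall>x. (\<exists>q<p. A q = x \<and> M' x = v q) \<or> ((\<forall>q<p. A q \<noteq> x) \<and> M' x = M x))"

text \<open>
  In the weakest preconditions below a store quantifies over all resolutions of the writes. Jumps are
  generated by the compilation of loops only, so they are excluded from straight-line code.
\<close>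

locale machine =
  fixes n p :: nat and orc :: "nat \<Rightarrow> nat set \<Rightarrow> real"
begin

fun wp :: "instr \<Rightarrow> assn \<Rightarrow> assn" where
  "wp (Const d k) Q V W M N = Q (V(d := \<lambda>_. k)) W M N"
| "wp (Move d s) Q V W M N = Q (V(d := V s)) W M N"
| "wp (Add d s t) Q V W M N = Q (V(d := \<lambda>q. V s q + V t q)) W M N"
| "wp (Sub d s t) Q V W M N = Q (V(d := \<lambda>q. V s q - V t q)) W M N"
| "wp (Less d s t) Q V W M N = Q (V(d := \<lambda>q. if V s q < V t q then 1 else 0)) W M N"
| "wp (CMove b d s) Q V W M N = Q (V(d := \<lambda>q. if V b q \<noteq> 0 then V s q else V d q)) W M N"
| "wp (Load d x) Q V W M N = Q (V(d := \<lambda>q. M (V x q))) W M N"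
| "wp (Store x s) Q V W M N = (\<forall>M'. outcome p (V x) (V s) M M' \<longrightarrow> Q V W M' N)"
| "wp (MoveR d s) Q V W M N = Q V (W(d := W s)) M N"
| "wp (LessR d s t) Q V W M N = Q (V(d := \<lambda>q. if W s q < W t q then 1 else 0)) W M N"
| "wp (CMoveR b d s) Q V W M N = Q V (W(d := \<lambda>q. if V b q \<noteq> 0 then W s q else W d q)) M N"
| "wp (LoadR d x) Q V W M N = Q V (W(d := \<lambda>q. N (V x q))) M N"
| "wp (StoreR x s) Q V W M N = (\<forall>N'. outcome p (V x) (W s) N N' \<longrightarrow> Q V W M N')"
| "wp (Jump l) Q V W M N = False"
| "wp (JumpZero b l) Q V W M N = False"
| "wp (Eval d y z) Q V W M N = Q V (W(d := \<lambda>q. orc (V y q) (decode_set n M (V z q)))) M N"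

fun wps :: "instr list \<Rightarrow> assn \<Rightarrow> assn" where
  "wps [] Q = Q"
| "wps (ins # is) Q = wp ins (wps is Q)"

definition at_pc :: "nat \<Rightarrow> config \<Rightarrow> assn" where
  "at_pc l c V W M N \<longleftrightarrow>
     (\<forall>q<p. procs c q = \<lparr>pc = l, reg = (\<lambda>r. V r q), rreg = (\<lambda>r. W r q)\<rparr>) \<and> mem c = M \<and> rmem c = N"

lemma step_procs:
  assumes "step prog n orc p c c'" "fetch prog (procs c q) = Some ins" "q < p"
  shows "procs c' q = exec orc n (mem c) (rmem c) ins (procs c q)"
  using assms by (simp add: step_def)

lemma step_no_write:
  assumes "step prog n orc p c c'" "\<And>x. writes prog p c x = {}" "\<And>x. rwrites prog p c x = {}"
  shows "mem c' = mem c" "rmem c' = rmem c"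
  using assms by (auto simp: step_def fun_eq_iff)

text \<open>
  Since all processors execute the same instruction, a step cannot mix loads, stores and jumps, and
  its effect is that of one vector instruction.
\<close>

lemma step_wp:
  assumes st: "step prog n orc p c c'" and at: "at_pc l c V W M N"
    and l: "l < length prog" and wp: "wp (prog ! l) Q V W M N"
  shows "\<exists>V' W' M' N'. at_pc (Suc l) c' V' W' M' N' \<and> Q V' W' M' N'"
proof -
  let ?ins = "prog ! l"
  have f: "fetch prog (procs c q) = Some ?ins" if "q < p" for q
    using at l that by (simp add: at_pc_def fetch_def)
  have pr: "procs c' q = exec orc n M N ?ins (procs c q)" if "q < p" for q
    using st at f[OF that] that by (simp add: step_def at_pc_def)
  have pq: "procs c q = \<lparr>pc = l, reg = (\<lambda>r. V r q), rreg = (\<lambda>r. W r q)\<rparr>" if "q < p" for q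
    using at that by (simp add: at_pc_def)
  have mM: "mem c = M" "rmem c = N" using at by (simp_all add: at_pc_def)
  have wr: "writes prog p c x = {v. \<exists>q<p. \<exists>r s. ?ins = Store r s \<and> V r q = x \<and> V s q = v}" for x
    unfolding writes_def by (intro Collect_cong ex_cong1 conj_cong refl) (simp_all add: f, simp_all add: pq)
  have rwr: "rwrites prog p c x = {v. \<exists>q<p. \<exists>r s. ?ins = StoreR r s \<and> V r q = x \<and> W s q = v}" for x
    unfolding rwrites_def by (intro Collect_cong ex_cong1 conj_cong refl) (simp_all add: f, simp_all add: pq)
  have m: "mem c' x \<in> (if writes prog p c x = {} then {M x} else writes prog p c x)" for x
    using st unfolding step_def mM by blast
  have rm: "rmem c' x \<in> (if rwrites prog p c x = {} then {N x} else rwrites prog p c x)" for x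
    using st unfolding step_def mM by blast
  have mS: "mem c' = M" if "\<And>r s. ?ins \<noteq> Store r s"
    using m that by (auto simp: wr)
  have rmS: "rmem c' = N" if "\<And>r s. ?ins \<noteq> StoreR r s"
    using rm that by (auto simp: rwr)
  have nat_case: ?thesis
    if "wp ?ins Q V W M N = Q (V(d := f)) W M N"
      and "\<And>q. q < p \<Longrightarrow> exec orc n M N ?ins (procs c q) = set_reg d (f q) (procs c q)"
      and "\<And>r s. ?ins \<noteq> Store r s" and "\<And>r s. ?ins \<noteq> StoreR r s" for d f
  proof -
    have "at_pc (Suc l) c' (V(d := f)) W M N"
      using that(2) pr pq mS[OF that(3)] rmS[OF that(4)]
      by (auto simp: at_pc_def set_reg_def fun_eq_iff)
    with that(1) wp show ?thesis by blast
  qed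
  have real_case: ?thesis
    if "wp ?ins Q V W M N = Q V (W(d := f)) M N"
      and "\<And>q. q < p \<Longrightarrow> exec orc n M N ?ins (procs c q) = set_rreg d (f q) (procs c q)"
      and "\<And>r s. ?ins \<noteq> Store r s" and "\<And>r s. ?ins \<noteq> StoreR r s" for d f
  proof -
    have "at_pc (Suc l) c' V (W(d := f)) M N"
      using that(2) pr pq mS[OF that(3)] rmS[OF that(4)]
      by (auto simp: at_pc_def set_rreg_def fun_eq_iff)
    with that(1) wp show ?thesis by blast
  qed
  show ?thesis
  proof (cases ?ins)
    case (Store r s)
    have "outcome p (V r) (V s) M (mem c')"
      unfolding outcome_def
    proof
      fix x
      show "(\<exists>q<p. V r q = x \<and> mem c' x = V s q) \<or> (\<forall>q<p. V r q \<noteq> x) \<and> mem c' x = M x"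
        using m[of x] by (auto simp: wr Store split: if_splits)
    qed
    then show ?thesis using wp pr pq mS rmS Store
      by (intro exI[of _ V] exI[of _ W] exI[of _ "mem c'"] exI[of _ N])
        (simp add: at_pc_def goto_def)
  next
    case (StoreR r s)
    have "outcome p (V r) (W s) N (rmem c')"
      unfolding outcome_def
    proof
      fix x
      show "(\<exists>q<p. V r q = x \<and> rmem c' x = W s q) \<or> (\<forall>q<p. V r q \<noteq> x) \<and> rmem c' x = N x"
        using rm[of x] by (auto simp: rwr StoreR split: if_splits)
    qed
    then show ?thesis using wp pr pq mS rmS StoreR
      by (intro exI[of _ V] exI[of _ W] exI[of _ M] exI[of _ "rmem c'"])
        (simp add: at_pc_def goto_def)
  next
    case (Const d k)
    then show ?thesis by (intro nat_case[of d "\<lambda>_. k"]) (simp_all add: pq)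
  next
    case (Move d s)
    then show ?thesis by (intro nat_case[of d "V s"]) (simp_all add: pq)
  next
    case (Add d s t)
    then show ?thesis by (intro nat_case[of d "\<lambda>q. V s q + V t q"]) (simp_all add: pq)
  next
    case (Sub d s t)
    then show ?thesis by (intro nat_case[of d "\<lambda>q. V s q - V t q"]) (simp_all add: pq)
  next
    case (Less d s t)
    then show ?thesis by (intro nat_case[of d "\<lambda>q. if V s q < V t q then 1 else 0"]) (simp_all add: pq)
  next
    case (CMove b d s)
    then show ?thesis by (intro nat_case[of d "\<lambda>q. if V b q \<noteq> 0 then V s q else V d q"]) (simp_all add: pq)
  next
    case (Load d x)
    then show ?thesis by (intro nat_case[of d "\<lambda>q. M (V x q)"]) (simp_all add: pq)
  next
    case (LessR d s t)
    then show ?thesis by (intro nat_case[of d "\<lambda>q. if W s q < W t q then 1 else 0"]) (simp_all add: pq)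
  next
    case (MoveR d s)
    then show ?thesis by (intro real_case[of d "W s"]) (simp_all add: pq)
  next
    case (CMoveR b d s)
    then show ?thesis by (intro real_case[of d "\<lambda>q. if V b q \<noteq> 0 then W s q else W d q"]) (simp_all add: pq)
  next
    case (LoadR d x)
    then show ?thesis by (intro real_case[of d "\<lambda>q. N (V x q)"]) (simp_all add: pq)
  next
    case (Eval d y z)
    then show ?thesis by (intro real_case[of d "\<lambda>q. orc (V y q) (decode_set n M (V z q))"]) (simp_all add: pq)
  qed (use wp in auto)
qed

text \<open>
  The triple bounds the number of steps by \<open>T\<close> and holds wherever the compiled code sits inside a
  larger program and whenever it is reached.
\<close>

definition hoare :: "assn \<Rightarrow> com \<Rightarrow> assn \<Rightarrow> nat \<Rightarrow> bool" where
  "hoare P C Q T \<longleftrightarrow> (\<forall>pre post c t V W M N.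
     let l = length pre; prog = pre @ compile l C @ post in
     (\<forall>t. step prog n orc p (c t) (c (Suc t))) \<longrightarrow> at_pc l (c t) V W M N \<longrightarrow> P V W M N \<longrightarrow>
     (\<exists>t' V' W' M' N'. t' \<le> T \<and> at_pc (l + csize C) (c (t + t')) V' W' M' N' \<and> Q V' W' M' N'))"

lemma hoareI:
  assumes "\<And>pre post prog c t V W M N. prog = pre @ compile (length pre) C @ post \<Longrightarrow>
     (\<And>t. step prog n orc p (c t) (c (Suc t))) \<Longrightarrow> at_pc (length pre) (c t) V W M N \<Longrightarrow> P V W M N \<Longrightarrow>
     \<exists>t' V' W' M' N'. t' \<le> T \<and> at_pc (length pre + csize C) (c (t + t')) V' W' M' N' \<and> Q V' W' M' N'"
  shows "hoare P C Q T"
  unfolding hoare_def Let_def by (intro allI impI) (rule assms, rule refl, blast+)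

lemma hoareD:
  assumes "hoare P C Q T" "prog = pre @ compile l C @ post" "l = length pre"
    "\<And>t. step prog n orc p (c t) (c (Suc t))" "at_pc l (c t) V W M N" "P V W M N"
  obtains t' V' W' M' N' where "t' \<le> T" "at_pc (l + csize C) (c (t + t')) V' W' M' N'"
    "Q V' W' M' N'"
proof -
  have "\<forall>t. step (pre @ compile (length pre) C @ post) n orc p (c t) (c (Suc t))"
    using assms by simp
  from assms(1)[unfolded hoare_def Let_def, rule_format, OF this[rule_format] assms(5)[unfolded assms(3)] assms(6)]
  show ?thesis using that assms(3) by blast
qed

lemma hoare_block:
  assumes "\<And>V W M N. P V W M N \<Longrightarrow> wps is Q V W M N"
  shows "hoare P (Block is) Q (length is)"
proof (rule hoareI)
  fix pre post prog c t V W M N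
  assume prog: "prog = pre @ compile (length pre) (Block is) @ post"
    and st: "\<And>t. step prog n orc p (c t) (c (Suc t))" and at: "at_pc (length pre) (c t) V W M N"
    and P: "P V W M N"
  from assms[OF P] prog at
  have "\<exists>V' W' M' N'. at_pc (length pre + length is) (c (t + length is)) V' W' M' N' \<and> Q V' W' M' N'"
  proof (induction "is" arbitrary: pre t V W M N)
    case Nil
    then show ?case by auto
  next
    case (Cons i "is")
    have "prog ! length pre = i" "length pre < length prog" using Cons.prems by auto
    then obtain V' W' M' N' where 1: "at_pc (Suc (length pre)) (c (Suc t)) V' W' M' N'"
      "wps is Q V' W' M' N'"
      using step_wp[OF st Cons.prems(3), of "wps is Q"] Cons.prems(1) by auto
    show ?case using Cons.IH[OF 1(2), of "pre @ [i]" "Suc t"] 1(1) Cons.prems(2) by auto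
  qed
  then show "\<exists>t' V' W' M' N'. t' \<le> length is \<and>
     at_pc (length pre + csize (Block is)) (c (t + t')) V' W' M' N' \<and> Q V' W' M' N'"
    by (intro exI[of _ "length is"]) simp
qed

lemma hoare_blockI:
  assumes "\<And>V W M N. P V W M N \<Longrightarrow> wps is Q V W M N" "length is = T"
  shows "hoare P (Block is) Q T"
  using hoare_block[of P "is" Q] assms by simp

lemma hoare_seq:
  assumes C: "hoare P C Q T" and D: "hoare Q D S T'"
  shows "hoare P (C ;; D) S (T + T')"
proof (rule hoareI)
  fix pre post prog c t V W M N
  assume prog: "prog = pre @ compile (length pre) (C ;; D) @ post"
    and st: "\<And>t. step prog n orc p (c t) (c (Suc t))" and at: "at_pc (length pre) (c t) V W M N"
    and P: "P V W M N"
  have len: "length pre + csize C = length (pre @ compile (length pre) C)" by simp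
  have prog1: "prog = pre @ compile (length pre) C @ (compile (length pre + csize C) D @ post)"
    and prog2: "prog = (pre @ compile (length pre) C) @ compile (length pre + csize C) D @ post"
    using prog by auto
  obtain t1 V1 W1 M1 N1 where 1: "t1 \<le> T" "at_pc (length pre + csize C) (c (t + t1)) V1 W1 M1 N1"
    "Q V1 W1 M1 N1"
    by (rule hoareD[OF C prog1 refl, where c = c and t = t and V = V and W = W and M = M and N = N, OF st at P])
  obtain t2 V2 W2 M2 N2 where "t2 \<le> T'"
    "at_pc (length pre + csize C + csize D) (c (t + t1 + t2)) V2 W2 M2 N2" "S V2 W2 M2 N2"
    by (rule hoareD[OF D prog2 len, where c = c and t = "t + t1" and V = V1 and W = W1 and M = M1 and N = N1, OF st 1(2,3)])
  with 1(1) show "\<exists>t' V' W' M' N'. t' \<le> T + T' \<and>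
     at_pc (length pre + csize (C ;; D)) (c (t + t')) V' W' M' N' \<and> S V' W' M' N'"
    by (intro exI[of _ "t1 + t2"] exI[of _ V2] exI[of _ W2] exI[of _ M2] exI[of _ N2])
      (auto simp: add.assoc)
qed

lemma hoare_conseq:
  assumes H: "hoare P C Q T" and P: "\<And>V W M N. P' V W M N \<Longrightarrow> P V W M N"
    and Q: "\<And>V W M N. Q V W M N \<Longrightarrow> Q' V W M N" and T: "T \<le> T'"
  shows "hoare P' C Q' T'"
proof (rule hoareI)
  fix pre post prog c t V W M N
  assume a: "prog = pre @ compile (length pre) C @ post"
    "\<And>t. step prog n orc p (c t) (c (Suc t))" "at_pc (length pre) (c t) V W M N" "P' V W M N"
  obtain t' V' W' M' N' where "t' \<le> T" "at_pc (length pre + csize C) (c (t + t')) V' W' M' N'"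
    "Q V' W' M' N'"
    by (rule hoareD[OF H a(1) refl, where c = c and t = t and V = V and W = W and M = M and N = N, OF a(2,3) P[OF a(4)]])
  then show "\<exists>t' V' W' M' N'. t' \<le> T' \<and>
     at_pc (length pre + csize C) (c (t + t')) V' W' M' N' \<and> Q' V' W' M' N'"
    using Q T by (meson order_trans)
qed

lemma hoare_ex:
  assumes H: "\<And>x. hoare (P x) C Q T"
  shows "hoare (\<lambda>V W M N. \<exists>x. P x V W M N) C Q T"
proof (rule hoareI)
  fix pre post prog c t V W M N
  assume a: "prog = pre @ compile (length pre) C @ post"
    "\<And>t. step prog n orc p (c t) (c (Suc t))" "at_pc (length pre) (c t) V W M N" "\<exists>x. P x V W M N"
  then obtain x where x: "P x V W M N" by blast
  show "\<exists>t' V' W' M' N'. t' \<le> T \<and>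
     at_pc (length pre + csize C) (c (t + t')) V' W' M' N' \<and> Q V' W' M' N'"
    by (rule hoareD[OF H[of x] a(1) refl, where c = c and t = t and V = V and W = W and M = M and N = N, OF a(2,3) x]) blast
qed

lemma hoare_mono_time:
  assumes "hoare P C Q T" "T \<le> T'"
  shows "hoare P C Q T'"
  using hoare_conseq[OF assms(1) _ _ assms(2)] by simp

lemma hoare_pure:
  assumes "A \<Longrightarrow> hoare P C Q T"
  shows "hoare (\<lambda>V W M N. A \<and> P V W M N) C Q T"
proof (cases A)
  case False
  then show ?thesis by (simp add: hoare_def)
qed (use assms in simp)

text \<open>
  The invariant is indexed by the number of completed iterations. It must tolerate a change of the
  scratch register \<open>3\<close>, and it must decide the test in the same way for every processor; otherwise the
  processors would leave the loop at different times.
\<close>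

lemma hoare_while:
  assumes body: "\<And>k. k < m \<Longrightarrow> hoare (I k) C (I (Suc k)) T"
    and tmp: "\<And>k V W M N v. I k V W M N \<Longrightarrow> I k (V(3 := v)) W M N"
    and go: "\<And>k V W M N q. k < m \<Longrightarrow> I k V W M N \<Longrightarrow> q < p \<Longrightarrow> V x q < V y q"
    and stop: "\<And>V W M N q. I m V W M N \<Longrightarrow> q < p \<Longrightarrow> \<not> V x q < V y q"
  shows "hoare (I 0) (While x y C) (I m) (m * (T + 3) + 2)"
proof (rule hoareI)
  fix pre post :: "instr list" and prog c t V W M N
  let ?l = "length pre"
  assume prog: "prog = pre @ compile ?l (While x y C) @ post"
    and st: "\<And>t. step prog n orc p (c t) (c (Suc t))" and at: "at_pc ?l (c t) V W M N"
    and P: "I 0 V W M N"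
  let ?e = "?l + csize C + 3"
  have i0: "prog ! ?l = Less 3 x y" "?l < length prog" using prog by auto
  have i1: "prog ! (Suc ?l) = JumpZero 3 ?e" "Suc ?l < length prog"
    using prog by (auto simp: nth_append)
  have i2: "prog ! (?l + 2 + csize C) = Jump ?l" "?l + 2 + csize C < length prog"
    using prog by (auto simp: nth_append)
  have prog2: "prog = (pre @ [Less 3 x y, JumpZero 3 ?e]) @ compile (?l + 2) C @ ([Jump ?l] @ post)"
    using prog by auto
  have len: "?l + 2 = length (pre @ [Less 3 x y, JumpZero 3 ?e])" by simp
  have test: "\<exists>V'. at_pc (if m \<le> k then ?e else ?l + 2) (c (t + 2)) V' W M N \<and> I k V' W M N"
    if at: "at_pc ?l (c t) V W M N" and I: "I k V W M N" and k: "k \<le> m" for t k V W M N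
  proof -
    let ?V = "V(3 := \<lambda>q. if V x q < V y q then 1 else 0)"
    obtain V' W' M' N' where 1: "at_pc (Suc ?l) (c (Suc t)) V' W' M' N'"
        and e: "V' = ?V" "W' = W" "M' = M" "N' = N"
      using step_wp[OF st at i0(2), of "\<lambda>V' W' M' N'. V' = ?V \<and> W' = W \<and> M' = M \<and> N' = N"] i0(1)
      by auto
    have b: "V' 3 q = (if m \<le> k then 0 else 1)" if "q < p" for q
      using go[OF _ I that] stop[of V W M N q] I that k e by (cases "k = m") auto
    have f: "fetch prog (procs (c (Suc t)) q) = Some (JumpZero 3 ?e)" if "q < p" for q
      using 1 i1 that by (simp add: at_pc_def fetch_def)
    have w: "writes prog p (c (Suc t)) a = {}" "rwrites prog p (c (Suc t)) a = {}" for a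
      using f by (auto simp: writes_def rwrites_def)
    have "mem (c (Suc (Suc t))) = M'" "rmem (c (Suc (Suc t))) = N'"
      using step_no_write[OF st w] 1 by (simp_all add: at_pc_def)
    moreover have "procs (c (Suc (Suc t))) q = goto (if m \<le> k then ?e else ?l + 2) (procs (c (Suc t)) q)"
      if "q < p" for q
      using step_procs[OF st f[OF that] that] b[OF that] that 1 by (simp add: at_pc_def)
    ultimately have "at_pc (if m \<le> k then ?e else ?l + 2) (c (t + 2)) V' W' M' N'"
      using 1 by (auto simp: at_pc_def goto_def)
    then show ?thesis using tmp[OF I] e by blast
  qed
  have jump: "at_pc ?l (c (Suc t)) V W M N" if at: "at_pc (?l + 2 + csize C) (c t) V W M N" for t V W M N
  proof -
    have f: "fetch prog (procs (c t) q) = Some (Jump ?l)" if "q < p" for q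
      using at i2 that by (simp add: at_pc_def fetch_def)
    have w: "writes prog p (c t) a = {}" "rwrites prog p (c t) a = {}" for a
      using f by (auto simp: writes_def rwrites_def)
    have "mem (c (Suc t)) = M" "rmem (c (Suc t)) = N"
      using step_no_write[OF st w] at by (simp_all add: at_pc_def)
    moreover have "procs (c (Suc t)) q = goto ?l (procs (c t) q)"
      if "q < p" for q
      using step_procs[OF st f[OF that] that] by simp
    ultimately show ?thesis
      using at by (auto simp: at_pc_def goto_def)
  qed
  have "\<exists>t' V' W' M' N'. t' \<le> (m - k) * (T + 3) + 2 \<and> at_pc ?e (c (t + t')) V' W' M' N' \<and> I m V' W' M' N'"
    if "at_pc ?l (c t) V W M N" "I k V W M N" "k \<le> m" for t k V W M N
    using that
  proof (induction "m - k" arbitrary: k t V W M N)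
    case 0
    then have "k = m" by simp
    with test[OF 0(2,3,4)] obtain V' where "at_pc ?e (c (t + 2)) V' W M N" "I m V' W M N" by auto
    then show ?case using \<open>k = m\<close> by (intro exI[of _ 2]) auto
  next
    case (Suc j)
    have km: "k < m" using Suc.hyps(2) by simp
    with test[OF Suc(3,4,5)] obtain V1 where 1: "at_pc (?l + 2) (c (t + 2)) V1 W M N" "I k V1 W M N"
      by auto
    obtain t2 V2 W2 M2 N2 where 2: "t2 \<le> T"
      "at_pc (?l + 2 + csize C) (c (t + 2 + t2)) V2 W2 M2 N2" "I (Suc k) V2 W2 M2 N2"
      by (rule hoareD[OF body[OF km] prog2 len, where c = c and t = "t + 2" and V = V1 and W = W and M = M and N = N, OF st 1])
    have "j = m - Suc k" "Suc k \<le> m" using Suc.hyps(2) km by auto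
    from Suc.hyps(1)[OF this(1) jump[OF 2(2)] 2(3) this(2)] obtain t3 V3 W3 M3 N3 where
      3: "t3 \<le> (m - Suc k) * (T + 3) + 2" "at_pc ?e (c (Suc (t + 2 + t2) + t3)) V3 W3 M3 N3" "I m V3 W3 M3 N3"
      by blast
    have "m - k = Suc (m - Suc k)" using km by simp
    then have "3 + t2 + t3 \<le> (m - k) * (T + 3) + 2" using 2(1) 3(1) by simp
    moreover have "Suc (t + 2 + t2) + t3 = t + (3 + t2 + t3)" by simp
    ultimately show ?case using 3 by metis
  qed
  from this[OF at P] show "\<exists>t' V' W' M' N'. t' \<le> m * (T + 3) + 2 \<and>
     at_pc (?l + csize (While x y C)) (c (t + t')) V' W' M' N' \<and> I m V' W' M' N'"
    by (auto simp: add.assoc)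
qed

text \<open>
  This is where \<open>g \<ge> 1\<close> enters: steps without an evaluation are charged as if they had one.
\<close>

lemma elapsed_le:
  assumes "g \<ge> 1"
  shows "elapsed prog p g c t \<le> g * real t"
proof -
  have "elapsed prog p g c t \<le> (\<Sum>s<t. g)"
    unfolding elapsed_def by (rule sum_mono) (use assms in \<open>auto simp: step_time_def\<close>)
  then show ?thesis by (simp add: mult.commute)
qed

lemma run_hoare:
  assumes H: "hoare P C Q T" and run: "is_run (compile 0 C) n orc p c"
    and P: "P (\<lambda>r q. ((\<lambda>_. 0)(0 := q, 1 := n, 2 := p)) r) (\<lambda>_ _. 0) (\<lambda>_. 0) (\<lambda>_. 0)" and g: "g \<ge> 1"
  shows "\<exists>t V' W' N'. halted (compile 0 C) p (c t) \<and> elapsed (compile 0 C) p g (c) t \<le> g * real T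
    \<and> Q V' W' (mem (c t)) N'"
proof -
  have st: "\<And>t. step (compile 0 C) n orc p (c t) (c (Suc t))" and c0: "c 0 = initial n p"
    using run by (auto simp: is_run_def)
  have at: "at_pc 0 (c 0) (\<lambda>r q. ((\<lambda>_. 0)(0 := q, 1 := n, 2 := p)) r) (\<lambda>_ _. 0) (\<lambda>_. 0) (\<lambda>_. 0)"
    by (auto simp: at_pc_def c0 initial_def fun_eq_iff)
  obtain t' V' W' M' N' where t': "t' \<le> T" "at_pc (0 + csize C) (c (0 + t')) V' W' M' N'" "Q V' W' M' N'"
    by (rule hoareD[OF H, where pre = "[]" and post = "[]" and l = 0 and prog = "compile 0 C" and c = c and t = 0
          and V = "\<lambda>r q. ((\<lambda>_. 0)(0 := q, 1 := n, 2 := p)) r" and W = "\<lambda>_ _. 0" and M = "\<lambda>_. 0"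
          and N = "\<lambda>_. 0", OF _ _ st at P]) simp_all
  then have "halted (compile 0 C) p (c t')" by (auto simp: halted_def at_pc_def fetch_def)
  moreover have "mem (c t') = M'" using t' by (auto simp: at_pc_def)
  moreover have "elapsed (compile 0 C) p g c t' \<le> g * real T"
  proof -
    have "elapsed (compile 0 C) p g c t' \<le> g * real t'" by (rule elapsed_le[OF g])
    also have "\<dots> \<le> g * real T" using g t'(1) by (intro mult_left_mono) auto
    finally show ?thesis .
  qed
  ultimately show ?thesis using t' by blast
qed

end

section \<open>Greedy chains and minimal maximizers\<close>

definition least_best :: "'a set \<Rightarrow> ('a \<Rightarrow> 'a set \<Rightarrow> real) \<Rightarrow> 'a \<Rightarrow> 'a set \<Rightarrow> real \<Rightarrow> bool" where
  "least_best X \<pi> i A b \<longleftrightarrow> i \<in> A \<and> A \<in> proper_subsets X \<and> linkage_min X \<pi> A = b \<and>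
     (\<forall>T\<in>proper_subsets X. i \<in> T \<longrightarrow> linkage_min X \<pi> T \<le> b \<and> (linkage_min X \<pi> T = b \<longrightarrow> A \<subseteq> T))"

lemma proper_subsets_iff: "T \<in> proper_subsets X \<longleftrightarrow> T \<subseteq> X \<and> T \<noteq> {} \<and> T \<noteq> X"
  by (auto simp: proper_subsets_def)

lemma linkage_min_le:
  assumes "finite X" "y \<in> X - T"
  shows "linkage_min X \<pi> T \<le> \<pi> y T"
  using assms by (auto simp: linkage_min_def)

lemma maximizers_iff:
  assumes "finite X" and S: "S \<in> proper_subsets X"
  shows "S \<in> maximizers X \<pi> \<longleftrightarrow> (\<forall>T\<in>proper_subsets X. linkage_min X \<pi> T \<le> linkage_min X \<pi> S)"
proof -
  have fin: "finite (proper_subsets X)" using assms by (simp add: proper_subsets_def)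
  show ?thesis
  proof
    assume "S \<in> maximizers X \<pi>"
    then show "\<forall>T\<in>proper_subsets X. linkage_min X \<pi> T \<le> linkage_min X \<pi> S"
      using fin by (auto simp: maximizers_def)
  next
    assume "\<forall>T\<in>proper_subsets X. linkage_min X \<pi> T \<le> linkage_min X \<pi> S"
    then have "Max (linkage_min X \<pi> ` proper_subsets X) = linkage_min X \<pi> S"
      using fin S by (intro Max_eqI) auto
    then show "S \<in> maximizers X \<pi>" using S by (simp add: maximizers_def)
  qed
qed

text \<open>
  Every maximizer contains some \<open>i\<close>, hence contains \<open>A i\<close>, which then is a maximizer too. So a
  maximizer \<open>A i\<close> is minimal iff \<open>A j = A i\<close> for all of its elements \<open>j\<close>, and this amounts to
  \<open>i \<in> A j\<close>. Requiring \<open>i \<le> j\<close> in addition picks the least element of the set as its only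
  representative.
\<close>

locale least_best_family =
  fixes n :: nat and orc :: "nat \<Rightarrow> nat set \<Rightarrow> real" and A :: "nat \<Rightarrow> nat set" and \<beta> :: "nat \<Rightarrow> real"
  assumes lb: "\<And>i. i < n \<Longrightarrow> least_best {..<n} orc i (A i) (\<beta> i)"
begin

definition rep :: "nat \<Rightarrow> bool" where
  "rep i \<longleftrightarrow> (\<forall>j<n. \<beta> j \<le> \<beta> i) \<and> (\<forall>j\<in>A i. i \<in> A j \<and> i \<le> j)"

lemma lbD:
  assumes "i < n"
  shows "i \<in> A i" "A i \<in> proper_subsets {..<n}" "linkage_min {..<n} orc (A i) = \<beta> i"
    "\<And>T. T \<in> proper_subsets {..<n} \<Longrightarrow> i \<in> T \<Longrightarrow> linkage_min {..<n} orc T \<le> \<beta> i"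
    "\<And>T. T \<in> proper_subsets {..<n} \<Longrightarrow> i \<in> T \<Longrightarrow> linkage_min {..<n} orc T = \<beta> i \<Longrightarrow> A i \<subseteq> T"
    "A i \<subseteq> {..<n}"
  using lb[OF assms] by (auto simp: least_best_def proper_subsets_iff)

lemma maximizer_iff:
  assumes "i < n"
  shows "A i \<in> maximizers {..<n} orc \<longleftrightarrow> (\<forall>j<n. \<beta> j \<le> \<beta> i)"
proof -
  have "(\<forall>T\<in>proper_subsets {..<n}. linkage_min {..<n} orc T \<le> \<beta> i) \<longleftrightarrow> (\<forall>j<n. \<beta> j \<le> \<beta> i)"
  proof safe
    fix j assume "\<forall>T\<in>proper_subsets {..<n}. linkage_min {..<n} orc T \<le> \<beta> i" "j < n"
    then show "\<beta> j \<le> \<beta> i" using lbD(2,3)[of j] by force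
  next
    fix T assume a: "\<forall>j<n. \<beta> j \<le> \<beta> i" "T \<in> proper_subsets {..<n}"
    then obtain j where "j \<in> T" "j < n" by (auto simp: proper_subsets_iff)
    then show "linkage_min {..<n} orc T \<le> \<beta> i" using a lbD(4)[of j T] by force
  qed
  then show ?thesis using assms lbD(2,3)[of i] by (simp add: maximizers_iff)
qed

lemma maximizer_contains:
  assumes T: "T \<in> maximizers {..<n} orc" and i: "i \<in> T"
  shows "i < n" "A i \<subseteq> T" "A i \<in> maximizers {..<n} orc" "linkage_min {..<n} orc T = \<beta> i"
proof -
  have T': "T \<in> proper_subsets {..<n}" using T by (simp add: maximizers_def)
  then show n: "i < n" using i by (auto simp: proper_subsets_iff)
  have "\<forall>S\<in>proper_subsets {..<n}. linkage_min {..<n} orc S \<le> linkage_min {..<n} orc T"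
    using T T' maximizers_iff[of "{..<n}" T orc] by simp
  then show eq: "linkage_min {..<n} orc T = \<beta> i"
    using lbD(2,3)[OF n] lbD(4)[OF n T' i] by force
  then show "A i \<subseteq> T" using lbD(5)[OF n T' i] by simp
  show "A i \<in> maximizers {..<n} orc"
    using T T' lbD(2,3)[OF n] eq by (simp add: maximizers_def)
qed

lemma rep_same:
  assumes "rep i" "i < n" "j \<in> A i"
  shows "A j = A i"
proof -
  have m: "A i \<in> maximizers {..<n} orc" using assms by (simp add: maximizer_iff rep_def)
  note j = maximizer_contains[OF m assms(3)]
  have "i \<in> A j" using assms by (auto simp: rep_def)
  from maximizer_contains(2)[OF j(3) this] j(2) show ?thesis by blast
qed

lemma inj_on_rep: "inj_on A {i. i < n \<and> rep i}"
proof (rule inj_onI)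
  fix i j assume ij: "i \<in> {i. i < n \<and> rep i}" "j \<in> {i. i < n \<and> rep i}" and eq: "A i = A j"
  have "j \<in> A i" unfolding eq by (rule lbD(1)) (use ij in simp)
  moreover have "i \<in> A j" unfolding eq[symmetric] by (rule lbD(1)) (use ij in simp)
  ultimately have "i \<le> j" "j \<le> i" using ij by (simp_all add: rep_def)
  then show "i = j" by simp
qed

lemma minimal_maximizers_rep: "minimal_maximizers {..<n} orc = A ` {i. i < n \<and> rep i}"
proof (intro equalityI subsetI)
  fix S assume "S \<in> minimal_maximizers {..<n} orc"
  then have S: "S \<in> maximizers {..<n} orc"
    and mn: "\<And>S'. S' \<in> maximizers {..<n} orc \<Longrightarrow> \<not> S' \<subset> S"
    by (auto simp: minimal_maximizers_def maximizers_def)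
  have same: "A j = S" if "j \<in> S" for j
    using maximizer_contains[OF S that] mn by blast
  have S': "S \<noteq> {}" "S \<subseteq> {..<n}" "finite S"
    using S finite_subset[of S "{..<n}"] by (auto simp: maximizers_def proper_subsets_iff)
  define i where "i = Min S"
  have i: "i \<in> S" "\<And>j. j \<in> S \<Longrightarrow> i \<le> j" using S' by (auto simp: i_def)
  have "i < n" using i S' by auto
  moreover have "rep i" unfolding rep_def
    using i same S maximizer_iff[OF \<open>i < n\<close>] by auto
  ultimately show "S \<in> A ` {i. i < n \<and> rep i}" using same[OF i(1)] by blast
next
  fix S assume "S \<in> A ` {i. i < n \<and> rep i}"
  then obtain i where i: "i < n" "rep i" "S = A i" by auto
  then have m: "A i \<in> maximizers {..<n} orc" by (simp add: maximizer_iff rep_def)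
  have "\<not> S' \<subset> A i" if S': "S' \<in> maximizers {..<n} orc" for S'
  proof
    assume sub: "S' \<subset> A i"
    obtain j where j: "j \<in> S'" using S' by (auto simp: maximizers_def proper_subsets_iff)
    have "A j \<subseteq> S'" by (rule maximizer_contains(2)[OF S' j])
    moreover have "A j = A i" using rep_same[OF i(2,1)] j sub by blast
    ultimately show False using sub by blast
  qed
  then show "S \<in> minimal_maximizers {..<n} orc"
    using m i by (auto simp: minimal_maximizers_def)
qed

end

text \<open>
  A chain is stored in one row of cells: the \<open>m\<close>-th element added has the value \<open>n - m + 1\<close> and
  elements not yet added have the value \<open>0\<close>. The row as a whole is then a valid oracle argument for
  the current set, and the earlier members of the chain are its upper level sets, so that a single
  threshold \<open>n - m\<close> suffices to remember one of them.
\<close>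

definition prefix :: "nat \<Rightarrow> (nat \<Rightarrow> nat) \<Rightarrow> nat \<Rightarrow> nat set" where
  "prefix n s m = {y. y < n \<and> n - m < s y}"

text \<open>
  The state of the chain of \<open>i\<close> when it has reached size \<open>k\<close>. The values seen so far are those of the
  sizes below \<open>k\<close>; \<open>\<theta>\<close> is the threshold of the first chain member with the best value \<open>b\<close>. With
  \<open>k = 1\<close> no value has been seen yet, and \<open>\<theta>\<close> and \<open>b\<close> are unconstrained.
\<close>

definition greedy_inv ::
    "nat \<Rightarrow> (nat \<Rightarrow> nat set \<Rightarrow> real) \<Rightarrow> nat \<Rightarrow> nat \<Rightarrow> (nat \<Rightarrow> nat) \<Rightarrow> nat \<Rightarrow> real \<Rightarrow> bool" where
  "greedy_inv n orc k i s \<theta> b \<longleftrightarrow>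
     (\<forall>m. 1 \<le> m \<and> m \<le> k \<longrightarrow> card (prefix n s m) = m \<and> i \<in> prefix n s m) \<and>
     {y. y < n \<and> s y \<noteq> 0} = prefix n s k \<and>
     (\<forall>m. 1 \<le> m \<and> m < k \<longrightarrow> (\<exists>x\<in>{..<n} - prefix n s m. prefix n s (Suc m) = insert x (prefix n s m) \<and>
        orc x (prefix n s m) = linkage_min {..<n} orc (prefix n s m))) \<and>
     (1 < k \<longrightarrow> (\<exists>m. 1 \<le> m \<and> m < k \<and> \<theta> = n - m \<and> b = linkage_min {..<n} orc (prefix n s m) \<and>
        (\<forall>m'. 1 \<le> m' \<and> m' < k \<longrightarrow> linkage_min {..<n} orc (prefix n s m') \<le> b) \<and>
        (\<forall>m'. 1 \<le> m' \<and> m' < m \<longrightarrow> linkage_min {..<n} orc (prefix n s m') < b)))"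

lemma greedy_inv_init:
  assumes "i < n" "\<And>y. y < n \<Longrightarrow> s y = (if y = i then n else 0)"
  shows "greedy_inv n orc 1 i s \<theta> b"
proof -
  have 1: "prefix n s 1 = {i}" using assms by (auto simp: prefix_def split: if_splits)
  have 2: "{y. y < n \<and> s y \<noteq> 0} = {i}" using assms by (auto split: if_splits)
  have "card (prefix n s m) = m \<and> i \<in> prefix n s m" if "1 \<le> m \<and> m \<le> 1" for m
  proof -
    have "m = 1" using that by simp
    then show ?thesis using 1 by simp
  qed
  then show ?thesis unfolding greedy_inv_def 1 2 by simp
qed

text \<open>
  A new value replaces the best one only if it is strictly better, so the first and therefore
  smallest best chain member is kept.
\<close>

lemma greedy_inv_step:
  assumes G: "greedy_inv n orc k i s \<theta> b" and k: "1 \<le> k" "k < n" and x: "x < n" "s x = 0"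
    and val: "v = orc x {y. y < n \<and> s y \<noteq> 0}"
    and mn: "v = linkage_min {..<n} orc {y. y < n \<and> s y \<noteq> 0}"
    and s': "\<And>y. y < n \<Longrightarrow> s' y = (if y = x then n - k else s y)"
    and better: "better \<longleftrightarrow> k = 1 \<or> b < v"
  shows "greedy_inv n orc (Suc k) i s' (if better then n - k else \<theta>) (if better then v else b)"
proof -
  note G' = G[unfolded greedy_inv_def]
  have card: "\<And>m. 1 \<le> m \<Longrightarrow> m \<le> k \<Longrightarrow> card (prefix n s m) = m \<and> i \<in> prefix n s m"
    and S: "{y. y < n \<and> s y \<noteq> 0} = prefix n s k"
    and greedy: "\<And>m. 1 \<le> m \<Longrightarrow> m < k \<Longrightarrow> \<exists>x\<in>{..<n} - prefix n s m. prefix n s (Suc m) = insert x (prefix n s m) \<and>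
        orc x (prefix n s m) = linkage_min {..<n} orc (prefix n s m)"
    using G' by (blast, blast, blast)
  have old: "prefix n s' m = prefix n s m" if "m \<le> k" for m
  proof -
    have "n - m < s' y \<longleftrightarrow> n - m < s y" if "y < n" for y
      using s'[OF that] x(2) diff_le_mono2[OF \<open>m \<le> k\<close>, of n] by (cases "y = x") auto
    then show ?thesis by (auto simp: prefix_def)
  qed
  have new: "prefix n s' (Suc k) = insert x (prefix n s k)"
  proof -
    have "n - Suc k < s y \<longleftrightarrow> n - k < s y" if "y < n" for y
    proof -
      have "s y = 0 \<or> n - k < s y" using S that unfolding prefix_def by blast
      then show ?thesis using k by auto
    qed
    then have "n - Suc k < s' y \<longleftrightarrow> y = x \<or> n - k < s y" if "y < n" for y
      using s'[OF that] that k by (cases "y = x") auto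
    then show ?thesis using x by (auto simp: prefix_def)
  qed
  have xk: "x \<notin> prefix n s k" using x k by (auto simp: prefix_def)
  have fin: "finite (prefix n s k)" by (simp add: prefix_def)
  have c1: "card (prefix n s' m) = m \<and> i \<in> prefix n s' m" if m: "1 \<le> m \<and> m \<le> Suc k" for m
  proof (cases "m = Suc k")
    case True
    then show ?thesis using card[of k] k xk fin by (simp add: new)
  next
    case False
    then show ?thesis using card[of m] m by (simp add: old)
  qed
  have c2: "{y. y < n \<and> s' y \<noteq> 0} = prefix n s' (Suc k)"
  proof -
    have "s' y \<noteq> 0 \<longleftrightarrow> y = x \<or> s y \<noteq> 0" if "y < n" for y
      using s'[OF that] k by simp
    then have "{y. y < n \<and> s' y \<noteq> 0} = insert x {y. y < n \<and> s y \<noteq> 0}" using x by auto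
    then show ?thesis using S new by simp
  qed
  have c3: "\<exists>x\<in>{..<n} - prefix n s' m. prefix n s' (Suc m) = insert x (prefix n s' m) \<and>
        orc x (prefix n s' m) = linkage_min {..<n} orc (prefix n s' m)" if m: "1 \<le> m \<and> m < Suc k" for m
  proof (cases "m = k")
    case True
    then show ?thesis using new x xk val mn old[of k] unfolding S by (intro bexI[of _ x]) simp_all
  next
    case False
    then have "1 \<le> m" "m < k" using m by simp_all
    then show ?thesis using greedy[of m] old[of m] old[of "Suc m"] by simp
  qed
  have vk: "linkage_min {..<n} orc (prefix n s' k) = v" using mn S by (simp add: old)
  let ?b = "if better then v else b"
  have c4: "\<exists>m. 1 \<le> m \<and> m < Suc k \<and> (if better then n - k else \<theta>) = n - m \<and>
       ?b = linkage_min {..<n} orc (prefix n s' m) \<and>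
        (\<forall>m'. 1 \<le> m' \<and> m' < Suc k \<longrightarrow> linkage_min {..<n} orc (prefix n s' m') \<le> ?b) \<and>
        (\<forall>m'. 1 \<le> m' \<and> m' < m \<longrightarrow> linkage_min {..<n} orc (prefix n s' m') < ?b)"
  proof (cases "k = 1")
    case True
    have "linkage_min {..<n} orc (prefix n s' m') \<le> v" if "1 \<le> m' \<and> m' < Suc k" for m'
    proof -
      have "m' = k" using that True by simp
      then show ?thesis using vk by simp
    qed
    then show ?thesis using True vk better by (intro exI[of _ 1]) simp
  next
    case False
    then obtain m where m: "1 \<le> m" "m < k" "\<theta> = n - m" "b = linkage_min {..<n} orc (prefix n s m)"
      "\<And>m'. 1 \<le> m' \<Longrightarrow> m' < k \<Longrightarrow> linkage_min {..<n} orc (prefix n s m') \<le> b"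
      "\<And>m'. 1 \<le> m' \<Longrightarrow> m' < m \<Longrightarrow> linkage_min {..<n} orc (prefix n s m') < b"
      using G'[THEN conjunct2, THEN conjunct2, THEN conjunct2] False k by auto
    show ?thesis
    proof (cases better)
      case True
      then have b: "b < v" using False better by simp
      have "linkage_min {..<n} orc (prefix n s' m') < v" if "1 \<le> m'" "m' < k" for m'
        using m(5)[OF that] b old[of m'] that by simp
      moreover have "linkage_min {..<n} orc (prefix n s' m') \<le> v" if "1 \<le> m'" "m' < Suc k" for m'
        using calculation[of m'] vk that by (cases "m' = k") auto
      ultimately show ?thesis using True k vk by (intro exI[of _ k]) simp
    next
      case nb: False
      then have b: "v \<le> b" using False better by simp
      have "linkage_min {..<n} orc (prefix n s' m') \<le> b" if "1 \<le> m'" "m' < Suc k" for m'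
        using m(5)[of m'] old[of m'] that b vk by (cases "m' = k") auto
      then show ?thesis using nb m by (intro exI[of _ m]) (simp add: old)
    qed
  qed
  show ?thesis unfolding greedy_inv_def
    by (rule conjI, use c1 in blast, rule conjI, rule c2, rule conjI, use c3 in blast, use c4 in blast)
qed

text \<open>
  For a proper \<open>T\<close> containing \<open>i\<close> let \<open>k\<close> be maximal such that the chain member of size \<open>k\<close> lies in
  \<open>T\<close>. The next element \<open>x\<close> added is outside \<open>T\<close>, and monotonicity bounds the value of \<open>T\<close> by
  \<open>\<pi> x T\<close> and then by the value of that chain member. If \<open>T\<close> attains the best value, so does the
  member of size \<open>k\<close>; hence the first best member is not larger than it and is contained in \<open>T\<close>.
\<close>

lemma greedy_inv_least_best:
  assumes mono: "monotone_linkage {..<n} orc" and n: "n \<ge> 2" and G: "greedy_inv n orc n i s \<theta> b"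
  shows "least_best {..<n} orc i {y. y < n \<and> \<theta> < s y} b"
proof -
  let ?M = "linkage_min {..<n} orc"
  have card: "card (prefix n s m) = m" "i \<in> prefix n s m" if "1 \<le> m" "m \<le> n" for m
    using G that unfolding greedy_inv_def by blast+
  have sub: "prefix n s m \<subseteq> {..<n}" for m by (auto simp: prefix_def)
  have fin: "finite (prefix n s m)" for m by (simp add: prefix_def)
  have proper: "prefix n s m \<in> proper_subsets {..<n}" if "1 \<le> m" "m < n" for m
    using card[of m] sub[of m] that by (auto simp: proper_subsets_iff)
  obtain m where m: "1 \<le> m" "m < n" "\<theta> = n - m" "b = ?M (prefix n s m)"
      "\<And>m'. 1 \<le> m' \<Longrightarrow> m' < n \<Longrightarrow> ?M (prefix n s m') \<le> b"
      "\<And>m'. 1 \<le> m' \<Longrightarrow> m' < m \<Longrightarrow> ?M (prefix n s m') < b"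
    using G[unfolded greedy_inv_def, THEN conjunct2, THEN conjunct2, THEN conjunct2] n by auto
  have A: "{y. y < n \<and> \<theta> < s y} = prefix n s m" by (simp add: prefix_def m(3))
  have "?M T \<le> b \<and> (?M T = b \<longrightarrow> prefix n s m \<subseteq> T)"
    if T: "T \<in> proper_subsets {..<n}" "i \<in> T" for T
  proof -
    have p1: "prefix n s 1 \<subseteq> T"
    proof -
      have "card (prefix n s 1) = 1" "i \<in> prefix n s 1" using card[of 1] n by auto
      then have "prefix n s 1 = {i}" by (metis card_1_singletonE singletonD)
      then show ?thesis using T by simp
    qed
    have pn: "\<not> prefix n s n \<subseteq> T"
    proof
      assume "prefix n s n \<subseteq> T"
      moreover have "prefix n s n = {..<n}"
        using card(1)[of n] n sub[of n] by (intro card_subset_eq) auto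
      ultimately show False using T by (auto simp: proper_subsets_iff)
    qed
    \<comment> \<open>the size of the first chain member that leaves \<open>T\<close>\<close>
    define l where "l = (LEAST l. \<not> prefix n s l \<subseteq> T \<and> 1 \<le> l)"
    have l: "\<not> prefix n s l \<subseteq> T" "1 \<le> l" "l \<le> n"
      using LeastI[of "\<lambda>l. \<not> prefix n s l \<subseteq> T \<and> 1 \<le> l" n] pn n
        Least_le[of "\<lambda>l. \<not> prefix n s l \<subseteq> T \<and> 1 \<le> l" n] by (auto simp: l_def)
    have l1: "l \<noteq> 1" using l p1 by metis
    define k where "k = l - 1"
    have k: "1 \<le> k" "k < n" "l = Suc k" using l l1 by (auto simp: k_def)
    have kT: "prefix n s k \<subseteq> T"
    proof -
      have "k < l" using k by simp
      from not_less_Least[OF this[unfolded l_def]] show ?thesis using k(1) by blast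
    qed
    obtain x where x: "x \<in> {..<n} - prefix n s k" "prefix n s (Suc k) = insert x (prefix n s k)"
       "orc x (prefix n s k) = ?M (prefix n s k)"
      using G k unfolding greedy_inv_def by blast
    have xT: "x \<in> {..<n} - T" using x l k kT by auto
    have "?M T \<le> orc x T" using xT by (intro linkage_min_le) auto
    also have "orc x T \<le> orc x (prefix n s k)"
      using mono xT T proper[OF k(1,2)] kT unfolding monotone_linkage_def by blast
    also have "\<dots> = ?M (prefix n s k)" by (rule x(3))
    finally have le: "?M T \<le> ?M (prefix n s k)" .
    moreover have "?M (prefix n s k) \<le> b" using m(5) k by blast
    moreover have "prefix n s m \<subseteq> T" if "?M T = b"
    proof -
      have "\<not> k < m" using m(6)[of k] k le that by fastforce
      then have "prefix n s m \<subseteq> prefix n s k" by (auto simp: prefix_def)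
      then show ?thesis using kT by blast
    qed
    ultimately show ?thesis by auto
  qed
  then show ?thesis unfolding least_best_def A using card[of m] m proper by auto
qed

text \<open>
  Elements of the current set carry meaningless linkage values, but a positive entry in the row.
  Comparing entries first and linkage values second therefore makes an element outside the set win.
\<close>

lemma greedy_inv_argmin:
  assumes G: "greedy_inv n orc k i s \<theta> b" and k: "1 \<le> k" "k < n" and x: "x < n"
    and v: "\<And>y. y < n \<Longrightarrow> v y = orc y {y. y < n \<and> s y \<noteq> 0}"
    and le: "\<And>y. y < n \<Longrightarrow> s x < s y \<or> s x = s y \<and> v x \<le> v y"
  shows "s x = 0" "v x = linkage_min {..<n} orc {y. y < n \<and> s y \<noteq> 0}"
proof -
  let ?S = "{y. y < n \<and> s y \<noteq> 0}"
  have "card ?S = k" using G k unfolding greedy_inv_def by force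
  then have "?S \<noteq> {..<n}" using k by (metis card_lessThan less_irrefl)
  then obtain y where "y < n" "s y = 0" by blast
  then show sx: "s x = 0" using le[of y] by auto
  have "Min ((\<lambda>y. orc y ?S) ` ({..<n} - ?S)) = v x"
  proof (rule Min_eqI)
    fix z assume "z \<in> (\<lambda>y. orc y ?S) ` ({..<n} - ?S)"
    then show "v x \<le> z" using le v sx by force
  qed (use x sx v in auto)
  then show "v x = linkage_min {..<n} orc ?S" by (simp add: linkage_min_def)
qed

lemma minimal_maximizers_eq:
  "minimal_maximizers X \<pi> = {S \<in> maximizers X \<pi>. \<forall>S'\<in>maximizers X \<pi>. \<not> S' \<subset> S}"
  by (auto simp: minimal_maximizers_def maximizers_def)

text \<open>
  The machine works on \<open>{..<n}\<close>; a numbering of \<open>X\<close> carries all notions over to \<open>X\<close>.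
\<close>

context
  fixes f :: "'b \<Rightarrow> 'a" and Y X and \<pi> :: "'a \<Rightarrow> 'a set \<Rightarrow> real" and orc
  assumes bij: "bij_betw f Y X" and orc: "orc = (\<lambda>i Z. \<pi> (f i) (f ` Z))"
begin

lemma proper_subsets_transfer: "proper_subsets X = (`) f ` proper_subsets Y"
proof -
  have b: "bij_betw ((`) f) (Pow Y) (Pow X)" by (rule bij_betw_Pow[OF bij])
  have "(`) f ` (Pow Y - {{}, Y}) = (`) f ` Pow Y - (`) f ` {{}, Y}"
    using b by (intro inj_on_image_set_diff[of _ "Pow Y"]) (auto simp: bij_betw_def)
  then show ?thesis using b bij by (simp add: proper_subsets_def bij_betw_def)
qed

lemma diff_transfer: "T \<subseteq> Y \<Longrightarrow> X - f ` T = f ` (Y - T)"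
  using bij by (auto simp: bij_betw_def inj_on_image_set_diff[of f Y])

lemma linkage_min_transfer: "T \<subseteq> Y \<Longrightarrow> linkage_min X \<pi> (f ` T) = linkage_min Y orc T"
  by (simp add: linkage_min_def diff_transfer image_image orc)

lemma monotone_transfer: "monotone_linkage X \<pi> \<Longrightarrow> monotone_linkage Y orc"
  unfolding monotone_linkage_def proper_subsets_transfer
  using diff_transfer by (auto simp: orc image_mono proper_subsets_iff)

lemma maximizers_transfer: "maximizers X \<pi> = (`) f ` maximizers Y orc"
proof -
  have "linkage_min X \<pi> ` proper_subsets X = linkage_min Y orc ` proper_subsets Y"
    unfolding proper_subsets_transfer image_image
    by (intro image_cong refl linkage_min_transfer) (simp add: proper_subsets_iff)
  then show ?thesis
    unfolding maximizers_def by (auto simp: proper_subsets_transfer proper_subsets_iff linkage_min_transfer)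
qed

lemma minimal_maximizers_transfer: "minimal_maximizers X \<pi> = (`) f ` minimal_maximizers Y orc"
proof -
  have sub: "f ` S \<subset> f ` T \<longleftrightarrow> S \<subset> T" if "S \<subseteq> Y" "T \<subseteq> Y" for S T
  proof -
    have inj: "inj_on f Y" using bij by (simp add: bij_betw_def)
    have "f ` S \<subseteq> f ` T \<longleftrightarrow> f ` (S \<union> T) = f ` T" by (auto simp: image_Un)
    also have "\<dots> \<longleftrightarrow> S \<subseteq> T" using inj_on_image_eq_iff[OF inj, of "S \<union> T" T] that by auto
    finally show ?thesis using inj_on_image_eq_iff[OF inj that] by (simp add: psubset_eq)
  qed
  have Y: "S \<subseteq> Y" if "S \<in> maximizers Y orc" for S
    using that by (auto simp: maximizers_def proper_subsets_iff)
  have iff: "(\<forall>S'\<in>(`) f ` maximizers Y orc. \<not> S' \<subset> f ` S) \<longleftrightarrow> (\<forall>S'\<in>maximizers Y orc. \<not> S' \<subset> S)"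
    if "S \<in> maximizers Y orc" for S
    by (simp add: sub Y that)
  have "{S \<in> maximizers Y orc. \<forall>S'\<in>(`) f ` maximizers Y orc. \<not> S' \<subset> f ` S} =
      {S \<in> maximizers Y orc. \<forall>S'\<in>maximizers Y orc. \<not> S' \<subset> S}"
    by (rule Collect_cong) (rule conj_cong[OF refl iff])
  then show ?thesis
    by (simp only: minimal_maximizers_eq maximizers_transfer Compr_image_eq)
qed

end

section \<open>Processor grid and memory layout\<close>

text \<open>
  Registers up to \<open>20\<close> keep their values after the prelude, except for the scratch register \<open>3\<close>.
  Registers \<open>21\<close> to \<open>23\<close> belong to the growing chains, and the others are temporary. Register \<open>4\<close> is
  never written and provides the constant \<open>0\<close>, which is also the address used for idle writes.
\<close>

abbreviation (input) rId :: nat where "rId \<equiv> 0"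
abbreviation (input) rN :: nat where "rN \<equiv> Suc 0"
abbreviation (input) rProcs :: nat where "rProcs \<equiv> 2"
abbreviation (input) rZero :: nat where "rZero \<equiv> 4"
abbreviation (input) rOne :: nat where "rOne \<equiv> 5"
abbreviation (input) rNN :: nat where "rNN \<equiv> 6"
abbreviation (input) rI :: nat where "rI \<equiv> 7"
abbreviation (input) rY :: nat where "rY \<equiv> 8"
abbreviation (input) rZ :: nat where "rZ \<equiv> 9"
abbreviation (input) rRow :: nat where "rRow \<equiv> 10"
abbreviation (input) rSlot :: nat where "rSlot \<equiv> 11"
abbreviation (input) rPtr :: nat where "rPtr \<equiv> 12"
abbreviation (input) rPtrZ :: nat where "rPtrZ \<equiv> 13"
abbreviation (input) rPtr0 :: nat where "rPtr0 \<equiv> 14"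
abbreviation (input) rFlag :: nat where "rFlag \<equiv> 15"
abbreviation (input) rFlag0 :: nat where "rFlag0 \<equiv> 16"
abbreviation (input) rAB :: nat where "rAB \<equiv> 17"
abbreviation (input) rB :: nat where "rB \<equiv> 18"
abbreviation (input) rLen :: nat where "rLen \<equiv> 19"
abbreviation (input) rW :: nat where "rW \<equiv> 20"
abbreviation (input) rK :: nat where "rK \<equiv> 21"
abbreviation (input) rThr :: nat where "rThr \<equiv> 22"
abbreviation (input) rFirst :: nat where "rFirst \<equiv> 23"
abbreviation (input) rJ :: nat where "rJ \<equiv> 24"
abbreviation (input) rAcc :: nat where "rAcc \<equiv> 25"
abbreviation (input) rMark :: nat where "rMark \<equiv> 26"
abbreviation (input) rE :: nat where "rE \<equiv> 27"
abbreviation (input) rCE :: nat where "rCE \<equiv> 28"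
abbreviation (input) rD :: nat where "rD \<equiv> 29"
abbreviation (input) rC :: nat where "rC \<equiv> 30"
abbreviation (input) rC1 :: nat where "rC1 \<equiv> 31"
abbreviation (input) rC2 :: nat where "rC2 \<equiv> 32"
abbreviation (input) rS1 :: nat where "rS1 \<equiv> 33"
abbreviation (input) rS2 :: nat where "rS2 \<equiv> 34"
abbreviation (input) rT :: nat where "rT \<equiv> 35"
abbreviation (input) rBad :: nat where "rBad \<equiv> 36"
abbreviation (input) rTot :: nat where "rTot \<equiv> 37"
abbreviation (input) rOut :: nat where "rOut \<equiv> 38"
abbreviation (input) rQ :: nat where "rQ \<equiv> 39"
abbreviation (input) rU :: nat where "rU \<equiv> 40"

abbreviation (input) fV :: nat where "fV \<equiv> 0"
abbreviation (input) fBest :: nat where "fBest \<equiv> 3"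
abbreviation (input) fMax :: nat where "fMax \<equiv> 4"

text \<open>
  The machine cannot multiply; \<open>n * n\<close> is obtained by repeated addition, and the coordinates of a
  processor by repeated subtraction, both within \<open>n\<close> iterations.
\<close>

definition square_code :: com where
  "square_code = While rK rN (Block [Add rNN rNN rN, Add rK rK rOne])"

definition shape_code :: "instr list" where
  "shape_code =
    [Less rC rN rProcs, Less rC1 rNN rProcs,
     Const rAB 1, CMove rC rAB rN, CMove rC1 rAB rNN,
     Const rB 1, CMove rC1 rB rN,
     Move rLen rN, CMove rC rLen rOne,
     Const rW 1, CMove rC rW rN, CMove rC1 rW rOne,
     Move rZ rId, Add rRow rNN rOne, Const rK 0]"

definition row_code :: com where
  "row_code = While rK rN (Block
    [Less rC rZ rAB, Sub rC rOne rC, Sub rT rZ rAB, CMove rC rZ rT, Add rI rI rC,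
     Add rT rRow rN, CMove rC rRow rT, Add rK rK rOne])"

definition column_code :: com where
  "column_code = While rK rN (Block
    [Less rC rZ rB, Sub rC rOne rC, Sub rT rZ rB, CMove rC rZ rT, Add rY rY rC, Add rK rK rOne])"

definition address_code :: "instr list" where
  "address_code =
    [Add rSlot rRow rY, Add rPtr rSlot rNN, Add rPtrZ rRow rZ, Add rPtrZ rPtrZ rNN,
     Add rPtr0 rRow rNN, Add rFlag rPtr rNN, Add rFlag0 rPtr0 rNN,
     Add rT rRow rI, Const rFirst 1, Const rK 1, Store rT rN]"

definition prelude :: com where
  "prelude = Block [Const rOne 1] ;; square_code ;; Block shape_code ;; row_code ;;
     Block [Const rK 0] ;; column_code ;; Block address_code"

lemma outcome_hit:
  assumes "outcome p A v M M'" "q < p" "A q = x" "\<And>q. q < p \<Longrightarrow> A q = x \<Longrightarrow> v q = u"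
  shows "M' x = u"
  using assms unfolding outcome_def by metis

lemma outcome_miss:
  assumes "outcome p A v M M'" "\<And>q. q < p \<Longrightarrow> A q \<noteq> x"
  shows "M' x = M x"
  using assms unfolding outcome_def by metis

lemma outcome_some:
  assumes "outcome p A v M M'" "q < p" "A q = x"
  obtains q' where "q' < p" "A q' = x" "M' x = v q'"
  using assms unfolding outcome_def by metis

text \<open>
  Processors form an \<open>n\<close> by \<open>a\<close> by \<open>b\<close> grid: \<open>a * b\<close> of them serve each chain. In each round
  a processor scans \<open>len\<close> candidates, and the doubling phase runs while the window is smaller than
  \<open>w\<close>. The three shapes are those for \<open>n\<close>, \<open>n ^ 2\<close> and \<open>n ^ 3\<close> processors.
\<close>

locale layout = machine n p orc for n p :: nat and orc +
  fixes a b len w :: nat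
  assumes n2: "2 \<le> n"
    and shape: "(a, b, len, w) \<in> {(1, 1, n, 1), (n, 1, 1, n), (n, n, 1, 1)}"
    and p: "p = n * a * b"
begin

definition row_of :: "nat \<Rightarrow> nat" where "row_of q = q div (a * b)"
definition col_of :: "nat \<Rightarrow> nat" where "col_of q = q mod (a * b) div b"
definition opp_of :: "nat \<Rightarrow> nat" where "opp_of q = q mod (a * b) mod b"

\<comment> \<open>Symbolic execution has to simplify inside the branches of conditional moves.\<close>
declare if_weak_cong [cong del]

lemma shape_facts:
  "a \<le> n" "b \<le> a" "0 < a" "0 < b" "a * len = n" "a + len = Suc n" "0 < len" "len \<le> n"
  "w = 1 \<or> w = n \<and> len = 1 \<and> a = n"
  using shape n2 by auto

lemma row_of_less: "q < p \<Longrightarrow> row_of q < n"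
  unfolding row_of_def p using shape_facts by (intro less_mult_imp_div_less) (simp add: mult.assoc)

lemma col_of_less: "col_of q < a"
  unfolding col_of_def using shape_facts by (intro less_mult_imp_div_less) simp

lemma opp_of_less: "opp_of q < b"
  unfolding opp_of_def using shape_facts by simp

lemma processor_exists:
  assumes "i < n" "y < a" "z < b"
  obtains q where "q < p" "row_of q = i" "col_of q = y" "opp_of q = z"
proof
  let ?r = "y * b + z"
  let ?q = "i * (a * b) + ?r"
  have r: "?r < a * b"
  proof -
    have "?r < y * b + b" using assms by simp
    also have "\<dots> = Suc y * b" by simp
    also have "\<dots> \<le> a * b" using assms by (intro mult_le_mono1) simp
    finally show ?thesis .
  qed
  have "?q < i * (a * b) + a * b" using r by simp
  also have "\<dots> = Suc i * (a * b)" by simp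
  also have "\<dots> \<le> n * (a * b)" using assms by (intro mult_le_mono1) simp
  finally show "?q < p" by (simp add: p mult.assoc)
  have m: "?q mod (a * b) = ?r"
    using r by (metis mod_less mod_mult_self3)
  show "row_of ?q = i" using r unfolding row_of_def by (metis add.right_neutral div_less div_mult_self3 less_nat_zero_code mult.commute add.commute)
  show "col_of ?q = y" using assms unfolding col_of_def m by simp
  show "opp_of ?q = z" using assms unfolding opp_of_def m by simp
qed

text \<open>
  Cells \<open>1\<close> to \<open>n * n\<close> are left free for the output. They are followed by three \<open>n\<close> by \<open>n\<close> tables, each
  \<open>n * n\<close> cells after the previous one: the chains (in the real bank, at the same addresses, the
  linkage values), pointers to candidates (later the thresholds and best values in column \<open>0\<close>), and
  flags. A pointer to a candidate is the address of its slot in the first table.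
\<close>

definition slot :: "nat \<Rightarrow> nat \<Rightarrow> nat" where
  "slot i y = n * n + 1 + n * i + y"

lemma slot_add: "slot i y + j = slot i (y + j)" by (simp add: slot_def)

lemma grid_less: "i < n \<Longrightarrow> y < n \<Longrightarrow> n * i + y < n * n"
proof -
  assume "i < n" "y < n"
  then have "n * i + y < n * Suc i" by simp
  also have "\<dots> \<le> n * n" using \<open>i < n\<close> by (intro mult_le_mono2) simp
  finally show ?thesis .
qed

lemma grid_inj: "y < n \<Longrightarrow> y' < n \<Longrightarrow> n * i + y = n * i' + y' \<longleftrightarrow> i = i' \<and> y = y'"
proof -
  assume "y < n" "y' < n"
  then have "(n * i + y) div n = i" "(n * i' + y') div n = i'" by simp_all
  then show ?thesis by auto
qed

lemma slot_eq [simp]: "y < n \<Longrightarrow> y' < n \<Longrightarrow> slot i y = slot i' y' \<longleftrightarrow> i = i' \<and> y = y'"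
  using grid_inj[of y y' i i'] by (simp add: slot_def)

lemma slot_bounds: "n * n < slot i y" "i < n \<Longrightarrow> y < n \<Longrightarrow> slot i y \<le> 2 * (n * n)"
  using grid_less[of i y] by (simp_all add: slot_def)

lemma slot_neq [simp]:
  assumes "i < n" "y < n" "i' < n" "y' < n"
  shows "slot i y \<noteq> slot i' y' + n * n" "slot i' y' + n * n \<noteq> slot i y"
    "slot i y \<noteq> slot i' y' + n * n + n * n" "slot i' y' + n * n + n * n \<noteq> slot i y"
    "slot i y + n * n \<noteq> slot i' y' + n * n + n * n" "slot i' y' + n * n + n * n \<noteq> slot i y + n * n"
  using slot_bounds[of i y] slot_bounds[of i' y'] assms by linarith+

lemma slot_pos [simp]: "slot i y \<noteq> 0" "0 < slot i y" "0 \<noteq> slot i y"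
  by (simp_all add: slot_def)

definition env :: "(nat \<Rightarrow> nat \<Rightarrow> nat) \<Rightarrow> bool" where
  "env V \<longleftrightarrow> (\<forall>q<p. V rN q = n \<and> V rZero q = 0 \<and> V rOne q = 1 \<and> V rNN q = n * n \<and>
     V rI q = row_of q \<and> V rY q = col_of q \<and> V rRow q = slot (row_of q) 0 \<and> V rSlot q = slot (row_of q) (col_of q) \<and>
     V rPtr q = slot (row_of q) (col_of q) + n * n \<and> V rPtrZ q = slot (row_of q) (opp_of q) + n * n \<and>
     V rPtr0 q = slot (row_of q) 0 + n * n \<and> V rFlag q = slot (row_of q) (col_of q) + n * n + n * n \<and>
     V rFlag0 q = slot (row_of q) 0 + n * n + n * n \<and> V rLen q = len \<and> V rW q = w)"

lemma env_cong:
  assumes "\<And>r. r \<le> 20 \<Longrightarrow> r \<noteq> 3 \<Longrightarrow> V r = V' r"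
  shows "env V = env V'"
  unfolding env_def by (simp add: assms)

lemma env_upd [simp]: "d = 3 \<or> 20 < d \<Longrightarrow> env (V(d := f)) = env V"
  by (rule env_cong) auto

lemma envD:
  assumes "env V" "q < p"
  shows "V rN q = n" "V rZero q = 0" "V rOne q = Suc 0" "V rNN q = n * n"
     "V rI q = row_of q" "V rY q = col_of q" "V rRow q = slot (row_of q) 0" "V rSlot q = slot (row_of q) (col_of q)"
     "V rPtr q = slot (row_of q) (col_of q) + n * n" "V rPtrZ q = slot (row_of q) (opp_of q) + n * n"
     "V rPtr0 q = slot (row_of q) 0 + n * n" "V rFlag q = slot (row_of q) (col_of q) + n * n + n * n"
     "V rFlag0 q = slot (row_of q) 0 + n * n + n * n" "V rLen q = len" "V rW q = w"
  using assms by (simp_all add: env_def)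

lemma columns: "col_of q < n" "opp_of q < n" "opp_of q < a"
  using col_of_less[of q] opp_of_less[of q] shape_facts by linarith+

text \<open>
  One step of division by repeated subtraction: the quotient is capped by the number \<open>j\<close> of
  subtractions tried so far.
\<close>

lemma div_step:
  fixes x B j :: nat
  assumes "0 < B"
  defines "m \<equiv> min j (x div B)"
  shows "min (Suc j) (x div B) = m + (if x - B * m < B then 0 else 1)"
proof (cases "j < x div B")
  case True
  then have "B * Suc j \<le> x" using assms by (metis Suc_leI div_times_less_eq_dividend dual_order.trans mult_le_mono2 times_div_less_eq_dividend)
  then show ?thesis using True by (auto simp: m_def)
next
  case False
  then have "m = x div B" by (simp add: m_def)
  moreover have "x - B * (x div B) < B" using assms by (simp add: minus_mult_div_eq_mod)
  ultimately show ?thesis using False by simp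
qed

definition start :: assn where
  "start V W M N \<longleftrightarrow> V = (\<lambda>r q. ((\<lambda>_. 0)(0 := q, 1 := n, 2 := p)) r) \<and> (\<forall>x. M x = 0)"

definition clear :: "nat set \<Rightarrow> assn" where
  "clear D V W M N \<longleftrightarrow> (\<forall>x. M x = 0) \<and>
     (\<forall>q<p. V rId q = q \<and> V rN q = n \<and> V rProcs q = p \<and> V rOne q = 1 \<and> (\<forall>r\<in>D. V r q = 0))"

definition shaped :: "nat set \<Rightarrow> assn" where
  "shaped D V W M N \<longleftrightarrow> (\<forall>x. M x = 0) \<and>
     (\<forall>q<p. V rN q = n \<and> V rOne q = 1 \<and> V rNN q = n * n \<and> V rAB q = a * b \<and> V rB q = b \<and>
        V rLen q = len \<and> V rW q = w \<and> (\<forall>r\<in>D. V r q = 0))"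

lemma square_hoare:
  "hoare (clear {rZero, rNN, rI, rY, rK}) square_code
    (\<lambda>V W M N. clear {rZero, rI, rY} V W M N \<and> (\<forall>q<p. V rNN q = n * n)) (n * (2 + 3) + 2)"
proof -
  let ?I = "\<lambda>j V W M N. clear {rZero, rI, rY} V W M N \<and> (\<forall>q<p. V rNN q = n * j \<and> V rK q = j)"
  have "hoare (?I 0) square_code (?I n) (n * (2 + 3) + 2)"
    unfolding square_code_def
  proof (rule hoare_while)
    fix j
    show "hoare (?I j) (Block [Add rNN rNN rN, Add rK rK rOne]) (?I (Suc j)) 2"
      by (rule hoare_blockI) (simp_all add: clear_def)
  qed (auto simp: clear_def)
  then show ?thesis by (rule hoare_conseq) (auto simp: clear_def)
qed

lemma shape_hoare:
  "hoare (\<lambda>V W M N. clear {rZero, rI, rY} V W M N \<and> (\<forall>q<p. V rNN q = n * n)) (Block shape_code)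
     (\<lambda>V W M N. shaped {rZero, rI, rY, rK} V W M N \<and> (\<forall>q<p. V rZ q = q \<and> V rRow q = slot 0 0)) 15"
proof -
  have f: "n < n * n" "n * n < n * n * n" "Suc 0 < n" "Suc 0 < n * n" "n \<noteq> Suc 0"
    using n2 by (simp_all add: one_less_mult)
  have v: "a = (if n < p then n else 1)"
    "b = (if n * n < p then n else 1)" "len = (if n < p then 1 else n)"
    "w = (if n * n < p then 1 else if n < p then n else 1)"
    using shape f by (auto simp: p) (use n2 in simp_all)
  have less: "n < p" if "n * n < p" using f(1) that by (rule less_trans)
  show ?thesis
  proof (rule hoare_blockI)
    fix V W M N
    assume "clear {rZero, rI, rY} V W M N \<and> (\<forall>q<p. V rNN q = n * n)"
    then show "wps shape_code (\<lambda>V W M N. shaped {rZero, rI, rY, rK} V W M N \<and>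
        (\<forall>q<p. V rZ q = q \<and> V rRow q = slot 0 0)) V W M N"
      by (simp add: clear_def shaped_def shape_code_def slot_def) (auto simp: v dest: less)
  qed (simp add: shape_code_def)
qed

lemma row_hoare:
  "hoare (\<lambda>V W M N. shaped {rZero, rI, rY, rK} V W M N \<and> (\<forall>q<p. V rZ q = q \<and> V rRow q = slot 0 0)) row_code
     (\<lambda>V W M N. shaped {rZero, rY} V W M N \<and>
        (\<forall>q<p. V rI q = row_of q \<and> V rZ q = q mod (a * b) \<and> V rRow q = slot (row_of q) 0)) (n * (8 + 3) + 2)"
proof -
  let ?B = "a * b"
  let ?m = "\<lambda>j q. min j (q div ?B)"
  let ?I = "\<lambda>j V W M N. shaped {rZero, rY} V W M N \<and>
     (\<forall>q<p. V rK q = j \<and> V rI q = ?m j q \<and> V rZ q = q - ?B * ?m j q \<and> V rRow q = slot (?m j q) 0)"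
  have B: "0 < ?B" using shape_facts by simp
  have "hoare (?I 0) row_code (?I n) (n * (8 + 3) + 2)"
    unfolding row_code_def
  proof (rule hoare_while)
    fix j
    let ?is = "[Less rC rZ rAB, Sub rC rOne rC, Sub rT rZ rAB, CMove rC rZ rT, Add rI rI rC,
     Add rT rRow rN, CMove rC rRow rT, Add rK rK rOne]"
    show "hoare (?I j) (Block ?is) (?I (Suc j)) 8"
    proof (rule hoare_blockI)
      fix V W M N assume "?I j V W M N"
      then show "wps ?is (?I (Suc j)) V W M N"
        by (simp add: shaped_def div_step[OF B] slot_def ac_simps distrib_left)
    qed simp
  qed (auto simp: shaped_def)
  then show ?thesis
  proof (rule hoare_conseq)
    fix V W M N assume I: "?I n V W M N"
    have "?m n q = row_of q" if "q < p" for q using row_of_less[OF that] by (simp add: row_of_def)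
    moreover have "q - ?B * row_of q = q mod ?B" for q by (simp add: row_of_def minus_mult_div_eq_mod)
    ultimately show "shaped {rZero, rY} V W M N \<and>
        (\<forall>q<p. V rI q = row_of q \<and> V rZ q = q mod (a * b) \<and> V rRow q = slot (row_of q) 0)"
      using I by simp
  qed (auto simp: shaped_def)
qed

lemma column_hoare:
  "hoare (\<lambda>V W M N. shaped {rZero, rY, rK} V W M N \<and>
        (\<forall>q<p. V rI q = row_of q \<and> V rZ q = q mod (a * b) \<and> V rRow q = slot (row_of q) 0)) column_code
     (\<lambda>V W M N. shaped {rZero} V W M N \<and>
        (\<forall>q<p. V rI q = row_of q \<and> V rY q = col_of q \<and> V rZ q = opp_of q \<and> V rRow q = slot (row_of q) 0)) (n * (6 + 3) + 2)"
proof -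
  let ?r = "\<lambda>q. q mod (a * b)"
  let ?m = "\<lambda>j q. min j (?r q div b)"
  let ?I = "\<lambda>j V W M N. shaped {rZero} V W M N \<and>
     (\<forall>q<p. V rI q = row_of q \<and> V rRow q = slot (row_of q) 0 \<and> V rK q = j \<and>
        V rY q = ?m j q \<and> V rZ q = ?r q - b * ?m j q)"
  have B: "0 < b" using shape_facts by simp
  have "hoare (?I 0) column_code (?I n) (n * (6 + 3) + 2)"
    unfolding column_code_def
  proof (rule hoare_while)
    fix j
    let ?is = "[Less rC rZ rB, Sub rC rOne rC, Sub rT rZ rB, CMove rC rZ rT, Add rY rY rC, Add rK rK rOne]"
    show "hoare (?I j) (Block ?is) (?I (Suc j)) 6"
    proof (rule hoare_blockI)
      fix V W M N assume "?I j V W M N"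
      then show "wps ?is (?I (Suc j)) V W M N"
        by (simp add: shaped_def div_step[OF B] ac_simps)
    qed simp
  qed (auto simp: shaped_def)
  then show ?thesis
  proof (rule hoare_conseq)
    fix V W M N assume I: "?I n V W M N"
    have "?m n q = col_of q" for q using columns(1)[of q] by (simp add: col_of_def)
    moreover have "?r q - b * col_of q = opp_of q" for q by (simp add: col_of_def opp_of_def minus_mult_div_eq_mod)
    ultimately show "shaped {rZero} V W M N \<and>
        (\<forall>q<p. V rI q = row_of q \<and> V rY q = col_of q \<and> V rZ q = opp_of q \<and> V rRow q = slot (row_of q) 0)"
      using I by simp
  qed (auto simp: shaped_def)
qed

definition greedy_start :: assn where
  "greedy_start V W M N \<longleftrightarrow> env V \<and> (\<forall>q<p. V rK q = 1 \<and> V rFirst q = 1) \<and>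
     (\<forall>i<n. \<forall>y<n. M (slot i y) = (if y = i then n else 0))"

lemma address_hoare:
  "hoare (\<lambda>V W M N. shaped {rZero} V W M N \<and>
        (\<forall>q<p. V rI q = row_of q \<and> V rY q = col_of q \<and> V rZ q = opp_of q \<and> V rRow q = slot (row_of q) 0))
     (Block address_code) greedy_start 11"
proof -
  show ?thesis
  proof (rule hoare_blockI)
    fix V W M N
    assume P: "shaped {rZero} V W M N \<and>
        (\<forall>q<p. V rI q = row_of q \<and> V rY q = col_of q \<and> V rZ q = opp_of q \<and> V rRow q = slot (row_of q) 0)"
    have M: "M' (slot i y) = (if y = i then n else 0)"
      if o: "outcome p (\<lambda>q. V rRow q + V rI q) (V rN) M M'" and iy: "i < n" "y < n" for M' i y
    proof (cases "y = i")
      case True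
      obtain q where q: "q < p" "row_of q = i"
        using processor_exists[of i 0 0] iy shape_facts by blast
      have "M' (slot i y) = n"
        by (rule outcome_hit[OF o q(1)]) (use P q True in \<open>auto simp: slot_def shaped_def\<close>)
      then show ?thesis using True by simp
    next
      case False
      have "M' (slot i y) = M (slot i y)"
        by (rule outcome_miss[OF o]) (use P row_of_less False iy in \<open>auto simp: slot_add\<close>)
      then show ?thesis using False P by (simp add: shaped_def)
    qed
    have N: "V rN q = n" if "q < p" for q using P that by (simp add: shaped_def)
    show "wps address_code greedy_start V W M N"
      using P M by (simp add: address_code_def greedy_start_def env_def shaped_def slot_add)
  qed (simp add: address_code_def)
qed

lemma prelude_hoare: "hoare start prelude greedy_start (42 * n)"
proof -
  have 1: "hoare start (Block [Const rOne 1]) (clear {rZero, rNN, rI, rY, rK}) 1"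
    by (rule hoare_blockI) (simp_all add: start_def clear_def)
  have 2: "hoare (\<lambda>V W M N. shaped {rZero, rY} V W M N \<and>
        (\<forall>q<p. V rI q = row_of q \<and> V rZ q = q mod (a * b) \<and> V rRow q = slot (row_of q) 0))
      (Block [Const rK 0])
      (\<lambda>V W M N. shaped {rZero, rY, rK} V W M N \<and>
        (\<forall>q<p. V rI q = row_of q \<and> V rZ q = q mod (a * b) \<and> V rRow q = slot (row_of q) 0)) 1"
    by (rule hoare_blockI) (simp_all add: shaped_def)
  show ?thesis unfolding prelude_def
    by (rule hoare_mono_time, (rule hoare_seq 1 square_hoare shape_hoare row_hoare 2 column_hoare address_hoare)+)
      (use n2 in simp)
qed

end

section \<open>Growing all greedy chains\<close>

text \<open>
  Sets \<open>rC\<close> to \<open>1\<close> or \<open>0\<close> according to whether the candidate at the address in \<open>x\<close> is strictly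
  better than the one at the address in \<open>y\<close>, in the lexicographic order of chain entries and linkage
  values.
\<close>

definition better :: "nat \<Rightarrow> nat \<Rightarrow> instr list" where
  "better x y =
    [Load rS1 x, Load rS2 y, LoadR 0 x, LoadR 1 y,
     Less rC1 rS1 rS2, Less rC2 rS2 rS1, LessR rC 0 1, CMove rC1 rC rC1, Sub rC rC rC2]"

definition lex_less :: "(nat \<Rightarrow> nat) \<Rightarrow> (nat \<Rightarrow> real) \<Rightarrow> nat \<Rightarrow> nat \<Rightarrow> bool" where
  "lex_less M N x y \<longleftrightarrow> M x < M y \<or> (\<not> M y < M x \<and> N x < N y)"

definition fill_start :: "instr list" where
  "fill_start = [Sub rMark rN rK, Move rAcc rSlot, Move rE rY, Move rCE rSlot, Const rJ 0]"

definition fill_body :: "instr list" where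
  "fill_body = [Eval fV rE rRow, StoreR rCE fV] @ better rCE rAcc @
    [CMove rC rAcc rCE, Add rE rE rOne, Add rCE rCE rOne, Add rJ rJ rOne]"

definition double_body :: "instr list" where
  "double_body = [Add rE rY rD, Less rC rE rN, Add rQ rPtr rD, Move rT rPtr, CMove rC rT rQ, Load rU rT] @
     better rU rAcc @ [CMove rC rAcc rU, Store rPtr rAcc, Add rD rD rD]"

definition duel_code :: "instr list" where
  "duel_code = [Load rU rPtrZ] @ better rU rAcc @ [Store rFlag rZero]"

definition lose_code :: "instr list" where
  "lose_code = [Move rT rZero, CMove rC rT rFlag, Store rT rOne]"

definition win_code :: "instr list" where
  "win_code = [Load rC1 rFlag, Move rT rPtr0, CMove rC1 rT rZero, Store rT rAcc]"

definition extend_code :: "instr list" where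
  "extend_code = [Load rAcc rPtr0, LoadR fV rAcc, LessR rC fBest fV, Add rC rC rFirst,
     CMoveR rC fBest fV, CMove rC rThr rMark, Const rFirst 0, Store rAcc rMark, Add rK rK rOne]"

definition round_code :: com where
  "round_code = Block fill_start ;; While rJ rLen (Block fill_body) ;;
     Block [Store rPtr rAcc, Const rD 1] ;; While rD rW (Block double_body) ;;
     Block duel_code ;; Block lose_code ;; Block win_code ;; Block extend_code"

definition greedy_code :: com where
  "greedy_code = While rK rN round_code"

context layout
begin

lemma slot_Suc: "Suc (slot i y) = slot i (Suc y)" by (simp add: slot_def)

lemma wps_append: "wps (is @ js) Q = wps is (wps js Q)"
  by (induction "is") auto

lemma wps_better:
  assumes "x < 30 \<or> 34 < x" "y < 30 \<or> 34 < y"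
  shows "wps (better x y) Q V W M N \<longleftrightarrow>
    Q (V(rS1 := \<lambda>q. M (V x q), rS2 := \<lambda>q. M (V y q),
         rC1 := \<lambda>q. if M (V x q) < M (V y q) then 1 else 0,
         rC2 := \<lambda>q. if M (V y q) < M (V x q) then 1 else 0,
         rC := \<lambda>q. if lex_less M N (V x q) (V y q) then 1 else 0))
      (W(0 := \<lambda>q. N (V x q), 1 := \<lambda>q. N (V y q))) M N"
proof -
  have "(\<lambda>q. (if 0 < (if M (V x q) < M (V y q) then 1 else 0 :: nat) then if M (V x q) < M (V y q) then 1 else 0
         else if N (V x q) < N (V y q) then 1 else 0) - (if M (V y q) < M (V x q) then 1 else 0)) =
      (\<lambda>q. if lex_less M N (V x q) (V y q) then 1 else 0 :: nat)"
    by (auto simp: lex_less_def fun_eq_iff)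
  then show ?thesis using assms by (auto simp: better_def fun_upd_twist)
qed

definition keyval :: "(nat \<Rightarrow> nat \<Rightarrow> nat) \<Rightarrow> nat \<Rightarrow> nat \<Rightarrow> real" where
  "keyval s i x = orc x {y. y < n \<and> s i y \<noteq> 0}"

text \<open>
  A total preorder on the candidates of chain \<open>i\<close>; see \<open>greedy_inv_argmin\<close> for why the chain entry
  comes first.
\<close>

definition key_le :: "(nat \<Rightarrow> nat \<Rightarrow> nat) \<Rightarrow> nat \<Rightarrow> nat \<Rightarrow> nat \<Rightarrow> bool" where
  "key_le s i x y \<longleftrightarrow> s i x < s i y \<or> (s i x = s i y \<and> keyval s i x \<le> keyval s i y)"

lemma key_le_refl [simp]: "key_le s i x x" by (simp add: key_le_def)
lemma key_le_trans: "key_le s i x y \<Longrightarrow> key_le s i y z \<Longrightarrow> key_le s i x z" by (auto simp: key_le_def)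
lemma key_le_total: "\<not> key_le s i x y \<Longrightarrow> key_le s i y x" by (auto simp: key_le_def)

lemma key_le_minimum:
  assumes "0 < m"
  shows "\<exists>x<m. \<forall>y<m. key_le s i x y"
  using assms
proof (induction m)
  case (Suc m)
  show ?case
  proof (cases "m = 0")
    case True
    then show ?thesis by auto
  next
    case False
    then obtain x where x: "x < m" "\<forall>y<m. key_le s i x y" using Suc by auto
    show ?thesis
    proof (cases "key_le s i x m")
      case True
      then show ?thesis using x by (intro exI[of _ x]) (auto simp: less_Suc_eq)
    next
      case False
      then have "key_le s i m x" by (rule key_le_total)
      then have "\<forall>y<m. key_le s i m y" using x key_le_trans by blast
      then show ?thesis by (intro exI[of _ m]) (auto simp: less_Suc_eq)
    qed
  qed
qed simp

lemma lex_less_iff: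
  assumes "M x' = s i x" "M y' = s i y" "N x' = keyval s i x" "N y' = keyval s i y"
  shows "lex_less M N x' y' \<longleftrightarrow> \<not> key_le s i y x"
  using assms by (auto simp: lex_less_def key_le_def)

text \<open>
  The part of the state that lasts through a round. Before the first comparison (\<open>k = 1\<close>) the
  registers for threshold and best value are not constrained; the register \<open>rFirst\<close> makes the first
  value win regardless of their contents.
\<close>

definition base :: "nat \<Rightarrow> (nat \<Rightarrow> nat \<Rightarrow> nat) \<Rightarrow> (nat \<Rightarrow> nat) \<Rightarrow> (nat \<Rightarrow> real) \<Rightarrow>
    (nat \<Rightarrow> nat \<Rightarrow> nat) \<Rightarrow> (nat \<Rightarrow> nat \<Rightarrow> real) \<Rightarrow> (nat \<Rightarrow> nat) \<Rightarrow> bool" where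
  "base k s \<theta> \<beta> V W M \<longleftrightarrow> env V \<and>
     (\<forall>q<p. V rK q = k \<and> V rFirst q = (if k = 1 then 1 else 0) \<and>
        (k \<noteq> 1 \<longrightarrow> V rThr q = \<theta> (row_of q) \<and> W fBest q = \<beta> (row_of q))) \<and>
     (\<forall>i<n. \<forall>y<n. M (slot i y) = s i y)"

lemma base_upd [simp]: "d = 3 \<or> 23 < d \<Longrightarrow> base k s \<theta> \<beta> (V(d := f)) W M = base k s \<theta> \<beta> V W M"
  by (auto simp: base_def)

lemma base_upd_real [simp]: "d \<noteq> 3 \<Longrightarrow> base k s \<theta> \<beta> V (W(d := f)) M = base k s \<theta> \<beta> V W M"
  by (simp add: base_def)

lemma base_mem:
  assumes "base k s \<theta> \<beta> V W M" "\<And>i y. i < n \<Longrightarrow> y < n \<Longrightarrow> M' (slot i y) = M (slot i y)"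
  shows "base k s \<theta> \<beta> V W M'"
  using assms by (simp add: base_def)

lemma base_env: "base k s \<theta> \<beta> V W M \<Longrightarrow> env V"
  by (simp add: base_def)

lemma decode_row:
  assumes "base k s \<theta> \<beta> V W M" "i < n"
  shows "orc x (decode_set n M (slot i 0)) = keyval s i x"
proof -
  have "decode_set n M (slot i 0) = {y. y < n \<and> s i y \<noteq> 0}"
    using assms by (auto simp: decode_set_def slot_add base_def)
  then show ?thesis by (simp add: keyval_def)
qed

lemma store_ptr:
  assumes o: "outcome p A v M M'"
    and A: "\<And>q. q < p \<Longrightarrow> A q = slot (row_of q) (col_of q) + n * n"
    and v: "\<And>q. q < p \<Longrightarrow> v q = u (row_of q) (col_of q)"
  shows "i < n \<Longrightarrow> y < a \<Longrightarrow> M' (slot i y + n * n) = u i y"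
    and "i < n \<Longrightarrow> y < n \<Longrightarrow> M' (slot i y) = M (slot i y)"
proof -
  assume iy: "i < n" "y < a"
  then obtain q where q: "q < p" "row_of q = i" "col_of q = y"
    using processor_exists[of i y 0] shape_facts by metis
  show "M' (slot i y + n * n) = u i y"
    by (rule outcome_hit[OF o q(1)])
      (use A v q iy columns shape_facts(1) in auto)
next
  assume iy: "i < n" "y < n"
  show "M' (slot i y) = M (slot i y)"
    by (rule outcome_miss[OF o]) (use A row_of_less columns iy in simp)
qed

definition rounds :: nat where "rounds = (LEAST t. w \<le> 2 ^ t)"

lemma rounds:
  "w \<le> 2 ^ rounds" "t < rounds \<Longrightarrow> 2 ^ t < w"
proof -
  have "w \<le> 2 ^ w" by (simp add: less_imp_le)
  then show "w \<le> 2 ^ rounds" unfolding rounds_def by (rule LeastI)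
  show "t < rounds \<Longrightarrow> 2 ^ t < w" unfolding rounds_def using not_less_Least[of t] by fastforce
qed

context
  fixes k :: nat and s :: "nat \<Rightarrow> nat \<Rightarrow> nat" and \<theta> :: "nat \<Rightarrow> nat" and \<beta> :: "nat \<Rightarrow> real"
  assumes k: "1 \<le> k" "k < n"
begin

text \<open>
  After \<open>j\<close> steps of the scan, column \<open>y\<close> has evaluated the candidates \<open>y\<close> to \<open>y + j - 1\<close> and points to
  the best of them. At \<open>j = 0\<close> the pointer already refers to the slot of \<open>y\<close>, whose value the first
  step supplies before comparing the slot with itself.
\<close>

definition filling :: "nat \<Rightarrow> assn" where
  "filling j V W M N \<longleftrightarrow> base k s \<theta> \<beta> V W M \<and>
     (\<forall>q<p. V rMark q = n - k \<and> V rJ q = j \<and> V rE q = col_of q + j \<and> V rCE q = slot (row_of q) (col_of q + j)) \<and>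
     (\<forall>i<n. \<forall>y<a. \<forall>x. y \<le> x \<and> x < y + j \<longrightarrow> N (slot i x) = keyval s i x) \<and>
     (\<exists>m. (\<forall>q<p. V rAcc q = slot (row_of q) (m (row_of q) (col_of q))) \<and>
        (\<forall>i<n. \<forall>y<a. y \<le> m i y \<and> (m i y < y + j \<or> m i y = y) \<and>
           (\<forall>x. y \<le> x \<and> x < y + j \<longrightarrow> key_le s i (m i y) x)))"

lemma fill_start_hoare: "hoare (\<lambda>V W M N. base k s \<theta> \<beta> V W M) (Block fill_start) (filling 0) 5"
proof (rule hoare_blockI)
  fix V W M N assume b: "base k s \<theta> \<beta> V W M"
  have K: "V rK q = k" if "q < p" for q using b that by (simp add: base_def)
  show "wps fill_start (filling 0) V W M N"
    using b by (auto simp: fill_start_def filling_def K envD[OF base_env[OF b]] intro!: exI[of _ "\<lambda>i y. y"])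
qed (simp add: fill_start_def)

lemma fill_step:
  assumes f: "filling j V W M N" and j: "j < len"
    and o: "outcome p (V rCE) (\<lambda>q. orc (V rE q) (decode_set n M (V rRow q))) N N'"
    and b: "base k s \<theta> \<beta> V' W' M"
    and V': "\<And>q. q < p \<Longrightarrow> V' rMark q = n - k \<and> V' rJ q = Suc j \<and> V' rE q = col_of q + Suc j \<and>
       V' rCE q = slot (row_of q) (col_of q + Suc j) \<and>
       V' rAcc q = (if lex_less M N' (V rCE q) (V rAcc q) then V rCE q else V rAcc q)"
  shows "filling (Suc j) V' W' M N'"
proof -
  note f' = f[unfolded filling_def]
  from f' obtain m where m0: "(\<forall>q<p. V rAcc q = slot (row_of q) (m (row_of q) (col_of q))) \<and>
        (\<forall>i<n. \<forall>y<a. y \<le> m i y \<and> (m i y < y + j \<or> m i y = y) \<and>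
           (\<forall>x. y \<le> x \<and> x < y + j \<longrightarrow> key_le s i (m i y) x))"
    by (elim conjE exE) (rule that, rule conjI)
  then have acc: "\<And>q. q < p \<Longrightarrow> V rAcc q = slot (row_of q) (m (row_of q) (col_of q))"
    and m: "\<And>i y. i < n \<Longrightarrow> y < a \<Longrightarrow> y \<le> m i y \<and> (m i y < y + j \<or> m i y = y)"
      "\<And>i y x. i < n \<Longrightarrow> y < a \<Longrightarrow> y \<le> x \<Longrightarrow> x < y + j \<Longrightarrow> key_le s i (m i y) x"
    by simp_all
  from f' have N: "\<And>i y x. i < n \<Longrightarrow> y < a \<Longrightarrow> y \<le> x \<Longrightarrow> x < y + j \<Longrightarrow> N (slot i x) = keyval s i x"
    and b0: "base k s \<theta> \<beta> V W M"
    and V: "\<And>q. q < p \<Longrightarrow> V rE q = col_of q + j \<and> V rCE q = slot (row_of q) (col_of q + j)"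
    by simp_all
  have v: "orc (V rE q) (decode_set n M (V rRow q)) = keyval s (row_of q) (col_of q + j)" if "q < p" for q
    using that V decode_row[OF b0 row_of_less[OF that]] envD[OF base_env[OF b0] that] by simp
  have less: "y + j < n" if "y < a" for y using that j shape_facts(6) by linarith
  have hit: "N' (slot i (y + j)) = keyval s i (y + j)" if iy: "i < n" "y < a" for i y
  proof -
    obtain q where q: "q < p" "row_of q = i" "col_of q = y"
      using processor_exists[of i y 0] shape_facts iy by metis
    show ?thesis
    proof (rule outcome_hit[OF o q(1)])
      show "V rCE q = slot i (y + j)" using V q by simp
      fix q' assume q': "q' < p" "V rCE q' = slot i (y + j)"
      then have "row_of q' = i" "col_of q' = y"
        using V[OF q'(1)] less[OF col_of_less[of q']] less[OF iy(2)] by simp_all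
      then show "orc (V rE q') (decode_set n M (V rRow q')) = keyval s i (y + j)"
        using v[OF q'(1)] by simp
    qed
  qed
  \<comment> \<open>An earlier value may be overwritten from another column, but only with the same value.\<close>
  have keep: "N' (slot i x) = keyval s i x \<or> N' (slot i x) = N (slot i x)" if "i < n" "x < n" for i x
  proof (cases "\<exists>q<p. V rCE q = slot i x")
    case True
    then obtain q where q: "q < p" "V rCE q = slot i x" by blast
    then have "row_of q = i" "col_of q + j = x" using V[OF q(1)] less[OF col_of_less] that by auto
    then have "N' (slot i x) = keyval s i x" using hit[of i "col_of q"] that col_of_less by auto
    then show ?thesis ..
  next
    case False
    then have "N' (slot i x) = N (slot i x)" by (intro outcome_miss[OF o]) auto
    then show ?thesis ..
  qed
  have N': "N' (slot i x) = keyval s i x" if "i < n" "y < a" "y \<le> x" "x < y + Suc j" for i y x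
  proof (cases "x = y + j")
    case True
    then show ?thesis using hit that by simp
  next
    case False
    then have "x < y + j" using that by simp
    then show ?thesis using keep[of i x] N[of i y x] less[of y] that by auto
  qed
  define m' where "m' = (\<lambda>i y. if key_le s i (m i y) (y + j) then m i y else y + j)"
  have lex: "lex_less M N' (slot i (y + j)) (slot i (m i y)) \<longleftrightarrow> \<not> key_le s i (m i y) (y + j)"
    if iy: "i < n" "y < a" for i y
  proof (rule lex_less_iff)
    have l: "y \<le> m i y" "m i y < y + Suc j" using m(1)[OF iy] by auto
    show "N' (slot i (y + j)) = keyval s i (y + j)" by (rule hit[OF iy])
    show "N' (slot i (m i y)) = keyval s i (m i y)" by (rule N'[OF iy l])
    show "M (slot i (y + j)) = s i (y + j)" "M (slot i (m i y)) = s i (m i y)"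
      using b0 iy less[OF iy(2)] l by (simp_all add: base_def)
  qed
  have acc': "V' rAcc q = slot (row_of q) (m' (row_of q) (col_of q))" if "q < p" for q
    using V'[OF that] V[OF that] acc[OF that] lex[OF row_of_less[OF that] col_of_less[of q]] by (simp add: m'_def)
  have "y \<le> m' i y \<and> (m' i y < y + Suc j \<or> m' i y = y) \<and>
           (\<forall>x. y \<le> x \<and> x < y + Suc j \<longrightarrow> key_le s i (m' i y) x)" if iy: "i < n" "y < a" for i y
  proof (intro conjI allI impI)
    show "y \<le> m' i y" "m' i y < y + Suc j \<or> m' i y = y" using m(1)[OF iy] by (auto simp: m'_def)
    fix x assume x: "y \<le> x \<and> x < y + Suc j"
    have "key_le s i (m' i y) (m i y)" "key_le s i (m' i y) (y + j)" by (auto simp: m'_def dest: key_le_total)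
    then show "key_le s i (m' i y) x"
      using m(2)[OF iy, of x] x key_le_trans by (cases "x = y + j") auto
  qed
  then show ?thesis unfolding filling_def
    using b V' N' acc' by blast
qed

lemma fill_hoare:
  "hoare (filling 0) (While rJ rLen (Block fill_body)) (filling len) (len * (15 + 3) + 2)"
proof (rule hoare_while)
  fix j assume j: "j < len"
  show "hoare (filling j) (Block fill_body) (filling (Suc j)) 15"
  proof (rule hoare_blockI)
    fix V W M N assume f: "filling j V W M N"
    then have b: "base k s \<theta> \<beta> V W M"
      and V: "\<And>q. q < p \<Longrightarrow> V rMark q = n - k \<and> V rJ q = j \<and> V rE q = col_of q + j \<and> V rCE q = slot (row_of q) (col_of q + j)"
      by (simp_all add: filling_def)
    show "wps fill_body (filling (Suc j)) V W M N"
      unfolding fill_body_def wps_append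
      using b V envD[OF base_env[OF b]]
      by (auto simp: wps_better slot_Suc intro!: fill_step[OF f j])
  qed (simp add: fill_body_def better_def)
next
  fix j V W M N and v assume "filling j V W M N"
  then show "filling j (V(3 := v)) W M N" by (simp add: filling_def)
next
  fix j V W M N q assume "j < len" "filling j V W M N" "q < p"
  then show "V rJ q < V rLen q" by (auto simp: filling_def base_def env_def)
next
  fix V W M N q assume "filling len V W M N" "q < p"
  then show "\<not> V rJ q < V rLen q" by (auto simp: filling_def base_def env_def)
qed


definition reduced :: "(nat \<Rightarrow> nat \<Rightarrow> nat) \<Rightarrow> assn" where
  "reduced m V W M N \<longleftrightarrow> base k s \<theta> \<beta> V W M \<and> (\<forall>q<p. V rMark q = n - k) \<and>
     (\<forall>i<n. \<forall>x<n. N (slot i x) = keyval s i x) \<and>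
     (\<forall>q<p. V rAcc q = slot (row_of q) (m (row_of q) (col_of q))) \<and>
     (\<forall>i<n. \<forall>y<a. M (slot i y + n * n) = slot i (m i y)) \<and> (\<forall>i<n. \<forall>y<a. m i y < n)"

text \<open>
  \<open>m i y\<close> is the candidate pointed to by column \<open>y\<close> of chain \<open>i\<close>; it beats the window of \<open>len * d\<close>
  candidates that starts at \<open>y\<close>.
\<close>

definition covers :: "nat \<Rightarrow> (nat \<Rightarrow> nat \<Rightarrow> nat) \<Rightarrow> bool" where
  "covers d m \<longleftrightarrow> (\<forall>i<n. \<forall>y<a. \<forall>x<n. y \<le> x \<and> x < y + len * d \<longrightarrow> key_le s i (m i y) x)"

definition doubling :: "nat \<Rightarrow> assn" where
  "doubling d V W M N \<longleftrightarrow> (\<exists>m. reduced m V W M N \<and> covers d m \<and> (\<forall>q<p. V rD q = d))"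

lemma publish_hoare: "hoare (filling len) (Block [Store rPtr rAcc, Const rD 1]) (doubling 1) 2"
proof (rule hoare_blockI)
  fix V W M N assume f: "filling len V W M N"
  note f' = f[unfolded filling_def]
  from f' obtain m where m0: "(\<forall>q<p. V rAcc q = slot (row_of q) (m (row_of q) (col_of q))) \<and>
        (\<forall>i<n. \<forall>y<a. y \<le> m i y \<and> (m i y < y + len \<or> m i y = y) \<and>
           (\<forall>x. y \<le> x \<and> x < y + len \<longrightarrow> key_le s i (m i y) x))"
    by (elim conjE exE) (rule that, rule conjI)
  have b: "base k s \<theta> \<beta> V W M" and mark: "\<forall>q<p. V rMark q = n - k" using f' by simp_all
  have acc: "\<And>q. q < p \<Longrightarrow> V rAcc q = slot (row_of q) (m (row_of q) (col_of q))" using m0 by simp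
  have ptr: "\<And>q. q < p \<Longrightarrow> V rPtr q = slot (row_of q) (col_of q) + n * n" using envD[OF base_env[OF b]] by simp
  have table: "N (slot i x) = keyval s i x" if "i < n" "x < n" for i x
  proof -
    have "min x (a - 1) < a" "min x (a - 1) \<le> x" "x < min x (a - 1) + len"
      using shape_facts(3,6,7) that by (auto simp: min_def)
    then show ?thesis using f' that by blast
  qed
  have less: "m i y < n" if iy: "i < n" "y < a" for i y
  proof -
    have "m i y < y + len \<or> m i y = y" using m0 iy by blast
    then show ?thesis using shape_facts(6,7) iy by linarith
  qed
  have cov: "covers 1 m" using m0 by (simp add: covers_def)
  have "reduced m V W M' N" if o: "outcome p (V rPtr) (V rAcc) M M'" for M'
  proof -
    note st = store_ptr[OF o, where u = "\<lambda>i y. slot i (m i y)", OF ptr acc]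
    have "base k s \<theta> \<beta> V W M'" by (rule base_mem[OF b st(2)])
    then show ?thesis unfolding reduced_def using mark table acc st(1) less by blast
  qed
  then have "doubling 1 (V(rD := \<lambda>_. 1)) W M' N" if "outcome p (V rPtr) (V rAcc) M M'" for M'
    unfolding doubling_def using cov that by (intro exI[of _ m]) (simp add: reduced_def)
  then show "wps [Store rPtr rAcc, Const rD 1] (doubling 1) V W M N" by simp
qed simp

text \<open>
  Two adjacent windows of width \<open>d\<close> make one of width \<open>d + d\<close>. A column whose partner would lie beyond
  the last column reads its own pointer instead.
\<close>

lemma double_step:
  assumes r: "reduced m V W M N" and c: "covers d m" and shape: "a = n" "len = 1"
    and D: "\<And>q. q < p \<Longrightarrow> V rD q = d"
  shows "wps double_body (doubling (d + d)) V W M N"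
proof -
  have aa: "y < a \<longleftrightarrow> y < n" for y using shape(1) by simp
  have b: "base k s \<theta> \<beta> V W M" and mark: "\<forall>q<p. V rMark q = n - k"
    and table: "\<And>i x. i < n \<Longrightarrow> x < n \<Longrightarrow> N (slot i x) = keyval s i x"
    and acc: "\<And>q. q < p \<Longrightarrow> V rAcc q = slot (row_of q) (m (row_of q) (col_of q))"
    and ptr: "\<And>i y. i < n \<Longrightarrow> y < n \<Longrightarrow> M (slot i y + n * n) = slot i (m i y)"
    and less: "\<And>i y. i < n \<Longrightarrow> y < n \<Longrightarrow> m i y < n"
    using r by (simp_all add: reduced_def aa)
  define z where "z = (\<lambda>i y. if y + d < n then m i (y + d) else m i y)"
  define m' where "m' = (\<lambda>i y. if key_le s i (m i y) (z i y) then m i y else z i y)"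
  have z: "z i y < n" if "i < n" "y < n" for i y using less that by (simp add: z_def)
  have lex: "lex_less M N (slot i (z i y)) (slot i (m i y)) \<longleftrightarrow> \<not> key_le s i (m i y) (z i y)"
    if "i < n" "y < n" for i y
    by (rule lex_less_iff) (use b z less table that in \<open>simp_all add: base_def\<close>)
  have less': "m' i y < n" if "i < n" "y < n" for i y
    using less z that by (simp add: m'_def)
  have cov: "covers (d + d) m'"
    unfolding covers_def
  proof (intro allI impI)
    fix i y x assume i: "i < n" and y: "y < a" and x: "x < n" and yx': "y \<le> x \<and> x < y + len * (d + d)"
    have yx: "y \<le> x" "x < y + (d + d)" using yx' shape(2) by simp_all
    have old: "key_le s i (m i y') x" if "y' < n" "y' \<le> x" "x < y' + d" for y'
      using c[unfolded covers_def] that i x aa shape(2) by simp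
    have 1: "key_le s i (m' i y) (m i y)" "key_le s i (m' i y) (z i y)" by (auto simp: m'_def dest: key_le_total)
    show "key_le s i (m' i y) x"
    proof (cases "x < y + d")
      case True
      then show ?thesis using old[of y] y yx 1(1) key_le_trans aa by blast
    next
      case False
      then have "y + d < n" using x by simp
      then have "key_le s i (z i y) x" using old[of "y + d"] False yx by (simp add: z_def)
      then show ?thesis using 1(2) key_le_trans by blast
    qed
  qed
  have load: "col_of q + d < n \<Longrightarrow> M (slot (row_of q) (col_of q) + n * n + d) = slot (row_of q) (z (row_of q) (col_of q))"
      "\<not> col_of q + d < n \<Longrightarrow> M (slot (row_of q) (col_of q) + n * n) = slot (row_of q) (z (row_of q) (col_of q))" if "q < p" for q
  proof -
    have e: "slot (row_of q) (col_of q) + n * n + d = slot (row_of q) (col_of q + d) + n * n" by (simp add: slot_def)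
    show "col_of q + d < n \<Longrightarrow> M (slot (row_of q) (col_of q) + n * n + d) = slot (row_of q) (z (row_of q) (col_of q))"
      "\<not> col_of q + d < n \<Longrightarrow> M (slot (row_of q) (col_of q) + n * n) = slot (row_of q) (z (row_of q) (col_of q))"
      unfolding e using ptr row_of_less[OF that] columns(1)[of q] by (simp_all add: z_def)
  qed
  have fin: "doubling (d + d) V' W' M' N"
    if o: "outcome p A v M M'" and A: "\<And>q. q < p \<Longrightarrow> A q = slot (row_of q) (col_of q) + n * n"
      and v: "\<And>q. q < p \<Longrightarrow> v q = slot (row_of q) (m' (row_of q) (col_of q))"
      and V': "base k s \<theta> \<beta> V' W' M"
        "\<And>q. q < p \<Longrightarrow> V' rMark q = n - k \<and> V' rAcc q = slot (row_of q) (m' (row_of q) (col_of q)) \<and> V' rD q = d + d"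
    for A v V' W' M'
  proof -
    note st = store_ptr[OF o, where u = "\<lambda>i y. slot i (m' i y)", OF A v]
    have "base k s \<theta> \<beta> V' W' M'" by (rule base_mem[OF V'(1) st(2)])
    then have "reduced m' V' W' M' N"
      using V'(2) table st(1) less' by (simp add: reduced_def aa)
    then show ?thesis using cov V'(2) unfolding doubling_def by blast
  qed
  show ?thesis
    unfolding double_body_def wps_append
    apply (simp add: wps_better)
    apply (intro allI impI)
    apply (erule fin)
    subgoal by (simp add: envD[OF base_env[OF b]])
    subgoal for M' q using lex[OF row_of_less columns(1), of q q]
      by (auto simp: envD[OF base_env[OF b]] D acc load m'_def)
    subgoal using b by simp
    subgoal for M' q using lex[OF row_of_less columns(1), of q q] mark
      by (auto simp: envD[OF base_env[OF b]] D acc load m'_def)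
    done
qed

lemma double_hoare:
  "hoare (doubling 1) (While rD rW (Block double_body)) (doubling (2 ^ rounds)) (rounds * (18 + 3) + 2)"
proof -
  have "hoare (doubling (2 ^ 0)) (While rD rW (Block double_body)) (doubling (2 ^ rounds)) (rounds * (18 + 3) + 2)"
  proof (rule hoare_while)
    fix t assume t: "t < rounds"
    show "hoare (doubling (2 ^ t)) (Block double_body) (doubling (2 ^ Suc t)) 18"
    proof (rule hoare_blockI)
      fix V W M N assume "doubling (2 ^ t) V W M N"
      then obtain m where m: "reduced m V W M N" "covers (2 ^ t) m" "\<And>q. q < p \<Longrightarrow> V rD q = 2 ^ t"
        unfolding doubling_def by blast
      have "w \<noteq> 1" using rounds(2)[OF t] by (metis less_one less_irrefl power_eq_0_iff zero_neq_numeral)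
      then have sh: "a = n" "len = 1" using shape_facts(9) by auto
      then show "wps double_body (doubling (2 ^ Suc t)) V W M N"
        using double_step[OF m(1,2) sh m(3)] by (simp add: mult_2)
    qed (simp add: double_body_def better_def)
  next
    fix t V W M N and v assume "doubling (2 ^ t) V W M N"
    then show "doubling (2 ^ t) (V(3 := v)) W M N" by (simp add: doubling_def reduced_def)
  next
    fix t V W M N q assume "t < rounds" "doubling (2 ^ t) V W M N" "q < p"
    then show "V rD q < V rW q" using rounds(2) by (auto simp: doubling_def reduced_def base_def env_def)
  next
    fix V W M N q assume "doubling (2 ^ rounds) V W M N" "q < p"
    then show "\<not> V rD q < V rW q" using rounds(1) by (auto simp: doubling_def reduced_def base_def env_def)
  qed
  then show ?thesis by simp
qed


text \<open>
  What the all-pairs comparison needs: some column with index below \<open>b\<close> already points to an optimal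
  candidate. A column is flagged iff it loses against one of these \<open>b\<close> columns, so the unflagged
  columns are exactly those with an optimal candidate.
\<close>

definition winning :: "(nat \<Rightarrow> nat \<Rightarrow> nat) \<Rightarrow> bool" where
  "winning m \<longleftrightarrow> (\<forall>i<n. \<exists>z<b. \<forall>x<n. key_le s i (m i z) x)"

text \<open>
  In the first two shapes \<open>b = 1\<close> and the window of column \<open>0\<close> covers everything. In the third shape
  every column is an opponent, and an optimal candidate is in its own window.
\<close>

lemma covers_winning:
  assumes c: "covers d m" and d: "w \<le> d" "0 < d"
  shows "winning m"
  unfolding winning_def
proof (intro allI impI)
  fix i assume i: "i < n"
  have cov: "key_le s i (m i y) x" if "y < a" "x < n" "y \<le> x" "x < y + len * d" for y x
    using c i that by (simp add: covers_def)
  consider "n \<le> len * d" | "len = 1" "b = n" "a = n" using shape d by auto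
  then show "\<exists>z<b. \<forall>x<n. key_le s i (m i z) x"
  proof cases
    case 1
    then show ?thesis using cov[of 0] shape_facts(3,4) by (intro exI[of _ 0]) auto
  next
    case 2
    obtain x0 where x0: "x0 < n" "\<And>y. y < n \<Longrightarrow> key_le s i x0 y"
      using key_le_minimum[of n s i] n2 by auto
    have "key_le s i (m i x0) x0" using cov[of x0 x0] x0 2 d by simp
    then have "\<forall>x<n. key_le s i (m i x0) x" using x0(2) key_le_trans by blast
    then show ?thesis using x0(1) 2 by auto
  qed
qed

definition selecting :: "(nat \<Rightarrow> nat \<Rightarrow> nat) \<Rightarrow> assn" where
  "selecting m V W M N \<longleftrightarrow> base k s \<theta> \<beta> V W M \<and> (\<forall>q<p. V rMark q = n - k) \<and>
     (\<forall>i<n. \<forall>x<n. N (slot i x) = keyval s i x) \<and>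
     (\<forall>q<p. V rAcc q = slot (row_of q) (m (row_of q) (col_of q)))"

lemma duel_hoare:
  "hoare (reduced m) (Block duel_code)
     (\<lambda>V W M N. selecting m V W M N \<and>
        (\<forall>q<p. V rC q = (if key_le s (row_of q) (m (row_of q) (col_of q)) (m (row_of q) (opp_of q)) then 0 else 1)) \<and>
        (\<forall>i<n. \<forall>y<a. M (slot i y + n * n + n * n) = 0)) 11"
proof (rule hoare_blockI)
  fix V W M N assume r: "reduced m V W M N"
  have b: "base k s \<theta> \<beta> V W M" and mark: "\<forall>q<p. V rMark q = n - k"
    and table: "\<And>i x. i < n \<Longrightarrow> x < n \<Longrightarrow> N (slot i x) = keyval s i x"
    and acc: "\<And>q. q < p \<Longrightarrow> V rAcc q = slot (row_of q) (m (row_of q) (col_of q))"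
    and ptr: "\<And>i y. i < n \<Longrightarrow> y < a \<Longrightarrow> M (slot i y + n * n) = slot i (m i y)"
    and less: "\<And>i y. i < n \<Longrightarrow> y < a \<Longrightarrow> m i y < n"
    using r by (simp_all add: reduced_def)
  note env = envD[OF base_env[OF b]]
  have load: "M (slot (row_of q) (opp_of q) + n * n) = slot (row_of q) (m (row_of q) (opp_of q))" if "q < p" for q
    using ptr row_of_less[OF that] columns(3) by blast
  have lex: "lex_less M N (slot (row_of q) (m (row_of q) (opp_of q))) (slot (row_of q) (m (row_of q) (col_of q))) \<longleftrightarrow>
      \<not> key_le s (row_of q) (m (row_of q) (col_of q)) (m (row_of q) (opp_of q))" if "q < p" for q
    by (rule lex_less_iff)
      (use b table row_of_less[OF that] less[OF row_of_less[OF that]] columns(3) col_of_less in \<open>simp_all add: base_def\<close>)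
  have zero: "(\<forall>i<n. \<forall>y<a. M' (slot i y + n * n + n * n) = 0) \<and> base k s \<theta> \<beta> V W M'"
    if o: "outcome p (V rFlag) (V rZero) M M'" for M'
  proof (intro conjI allI impI)
    fix i y assume iy: "i < n" "y < a"
    then obtain q where q: "q < p" "row_of q = i" "col_of q = y"
      using processor_exists[of i y 0] shape_facts(4) by metis
    show "M' (slot i y + n * n + n * n) = 0"
      by (rule outcome_hit[OF o q(1)]) (use q env in simp_all)
  next
    show "base k s \<theta> \<beta> V W M'"
    proof (rule base_mem[OF b])
      fix i y assume "i < n" "y < n"
      then show "M' (slot i y) = M (slot i y)"
        by (intro outcome_miss[OF o]) (simp add: env row_of_less columns)
    qed
  qed
  show "wps duel_code (\<lambda>V W M N. selecting m V W M N \<and>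
        (\<forall>q<p. V rC q = (if key_le s (row_of q) (m (row_of q) (col_of q)) (m (row_of q) (opp_of q)) then 0 else 1)) \<and>
        (\<forall>i<n. \<forall>y<a. M (slot i y + n * n + n * n) = 0)) V W M N"
    unfolding duel_code_def wps_append
    using zero mark table acc by (simp add: wps_better selecting_def env load lex)
qed (simp add: duel_code_def better_def)

lemma lose_hoare:
  "hoare (\<lambda>V W M N. selecting m V W M N \<and>
        (\<forall>q<p. V rC q = (if key_le s (row_of q) (m (row_of q) (col_of q)) (m (row_of q) (opp_of q)) then 0 else 1)) \<and>
        (\<forall>i<n. \<forall>y<a. M (slot i y + n * n + n * n) = 0)) (Block lose_code)
     (\<lambda>V W M N. selecting m V W M N \<and>
        (\<forall>i<n. \<forall>y<a. M (slot i y + n * n + n * n) = 0 \<longleftrightarrow> (\<forall>z<b. key_le s i (m i y) (m i z)))) 3"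
proof (rule hoare_blockI)
  fix V W M N
  assume r: "selecting m V W M N \<and>
        (\<forall>q<p. V rC q = (if key_le s (row_of q) (m (row_of q) (col_of q)) (m (row_of q) (opp_of q)) then 0 else 1)) \<and>
        (\<forall>i<n. \<forall>y<a. M (slot i y + n * n + n * n) = 0)"
  have b: "base k s \<theta> \<beta> V W M" using r by (simp add: selecting_def)
  note env = envD[OF base_env[OF b]]
  let ?loses = "\<lambda>q. \<not> key_le s (row_of q) (m (row_of q) (col_of q)) (m (row_of q) (opp_of q))"
  let ?A = "\<lambda>q. if 0 < V rC q then V rFlag q else V rZero q"
  have A: "?A q = (if ?loses q then slot (row_of q) (col_of q) + n * n + n * n else 0)" if "q < p" for q
    using r that env by simp
  have flag: "M' (slot i y + n * n + n * n) = 0 \<longleftrightarrow> (\<forall>z<b. key_le s i (m i y) (m i z))"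
    if o: "outcome p ?A (V rOne) M M'" and iy: "i < n" "y < a" for M' i y
  proof (cases "\<forall>z<b. key_le s i (m i y) (m i z)")
    case True
    have "M' (slot i y + n * n + n * n) = M (slot i y + n * n + n * n)"
    proof (rule outcome_miss[OF o])
      fix q assume q: "q < p"
      show "?A q \<noteq> slot i y + n * n + n * n"
      proof
        assume e: "?A q = slot i y + n * n + n * n"
        then have "?loses q" using A[OF q] by (auto split: if_splits)
        moreover from this have "row_of q = i" "col_of q = y"
          using e A[OF q] iy columns(1)[of q] shape_facts(1) by simp_all
        ultimately show False using True opp_of_less[of q] by auto
      qed
    qed
    then show ?thesis using r iy True by simp
  next
    case False
    then obtain z where z: "z < b" "\<not> key_le s i (m i y) (m i z)" by auto
    obtain q where q: "q < p" "row_of q = i" "col_of q = y" "opp_of q = z"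
      using processor_exists[OF iy z(1)] by metis
    have "M' (slot i y + n * n + n * n) = 1"
      by (rule outcome_hit[OF o q(1)]) (use q z A[OF q(1)] env in simp_all)
    then show ?thesis using False by simp
  qed
  have keep: "selecting m V W M' N" if o: "outcome p ?A (V rOne) M M'" for M'
  proof -
    have "base k s \<theta> \<beta> V W M'"
    proof (rule base_mem[OF b])
      fix i y assume "i < n" "y < n"
      then show "M' (slot i y) = M (slot i y)"
        by (intro outcome_miss[OF o]) (simp add: env row_of_less columns)
    qed
    then show ?thesis using r by (simp add: selecting_def)
  qed
  show "wps lose_code (\<lambda>V W M N. selecting m V W M N \<and>
        (\<forall>i<n. \<forall>y<a. M (slot i y + n * n + n * n) = 0 \<longleftrightarrow> (\<forall>z<b. key_le s i (m i y) (m i z)))) V W M N"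
    using flag keep by (simp add: lose_code_def selecting_def)
qed (simp add: lose_code_def)

definition selected :: "(nat \<Rightarrow> nat) \<Rightarrow> assn" where
  "selected \<mu> V W M N \<longleftrightarrow> base k s \<theta> \<beta> V W M \<and> (\<forall>q<p. V rMark q = n - k) \<and>
     (\<forall>i<n. \<forall>x<n. N (slot i x) = keyval s i x) \<and>
     (\<forall>i<n. M (slot i 0 + n * n) = slot i (\<mu> i) \<and> \<mu> i < n \<and> (\<forall>x<n. key_le s i (\<mu> i) x))"

text \<open>
  Several unflagged columns may write different pointers to the same cell. Each of them is optimal,
  so it does not matter which write succeeds.
\<close>

lemma win_hoare:
  assumes win: "winning m" and less: "\<forall>i<n. \<forall>y<a. m i y < n"
  shows "hoare (\<lambda>V W M N. selecting m V W M N \<and>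
        (\<forall>i<n. \<forall>y<a. M (slot i y + n * n + n * n) = 0 \<longleftrightarrow> (\<forall>z<b. key_le s i (m i y) (m i z))))
     (Block win_code) (\<lambda>V W M N. \<exists>\<mu>. selected \<mu> V W M N) 4"
proof (rule hoare_blockI)
  fix V W M N
  assume r: "selecting m V W M N \<and>
        (\<forall>i<n. \<forall>y<a. M (slot i y + n * n + n * n) = 0 \<longleftrightarrow> (\<forall>z<b. key_le s i (m i y) (m i z)))"
  have b: "base k s \<theta> \<beta> V W M"
    and acc: "\<And>q. q < p \<Longrightarrow> V rAcc q = slot (row_of q) (m (row_of q) (col_of q))"
    using r by (simp_all add: selecting_def)
  note env = envD[OF base_env[OF b]]
  let ?wins = "\<lambda>q. \<forall>z<b. key_le s (row_of q) (m (row_of q) (col_of q)) (m (row_of q) z)"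
  let ?A = "\<lambda>q. if 0 < M (V rFlag q) then V rZero q else V rPtr0 q"
  have A: "?A q = (if ?wins q then slot (row_of q) 0 + n * n else 0)" if "q < p" for q
    using conjunct2[OF r, rule_format, OF row_of_less[OF that] col_of_less[of q]] env that by auto
  have n0: "0 < n" using n2 by simp
  have ex: "\<exists>x<n. M' (slot i 0 + n * n) = slot i x \<and> (\<forall>x'<n. key_le s i x x')"
    if o: "outcome p ?A (V rAcc) M M'" and i: "i < n" for M' i
  proof -
    obtain z0 where z0: "z0 < b" "\<And>x. x < n \<Longrightarrow> key_le s i (m i z0) x" using win i by (auto simp: winning_def)
    have ba: "z < a" if "z < b" for z using that shape_facts(2) by simp
    obtain q0 where q0: "q0 < p" "row_of q0 = i" "col_of q0 = z0"
      using processor_exists[OF i ba[OF z0(1)] z0(1)] by metis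
    have "?wins q0" using z0 q0 less i ba by simp
    then have "?A q0 = slot i 0 + n * n" using A[OF q0(1)] q0 by simp
    from outcome_some[OF o q0(1) this] obtain q where q: "q < p" "?A q = slot i 0 + n * n"
      "M' (slot i 0 + n * n) = V rAcc q" by blast
    from q(2) have wins: "?wins q" and row_of: "row_of q = i" using A[OF q(1)] n0 by (auto split: if_splits)
    have "key_le s i (m i (col_of q)) (m i z0)" using wins z0(1) row_of by simp
    then have "\<forall>x'<n. key_le s i (m i (col_of q)) x'" using z0(2) key_le_trans by blast
    moreover have "m i (col_of q) < n" using less i col_of_less by blast
    ultimately show ?thesis using q(3) acc[OF q(1)] row_of by auto
  qed
  have "\<exists>\<mu>. selected \<mu> V W M' N" if o: "outcome p ?A (V rAcc) M M'" for M'
  proof -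
    obtain \<mu> where mu: "\<And>i. i < n \<Longrightarrow> \<mu> i < n \<and> M' (slot i 0 + n * n) = slot i (\<mu> i) \<and> (\<forall>x'<n. key_le s i (\<mu> i) x')"
      using ex[OF o] by metis
    have "base k s \<theta> \<beta> V W M'"
    proof (rule base_mem[OF b])
      fix i y assume "i < n" "y < n"
      then show "M' (slot i y) = M (slot i y)"
        by (intro outcome_miss[OF o]) (simp add: env row_of_less columns n0)
    qed
    then show ?thesis using r mu by (intro exI[of _ \<mu>]) (simp add: selected_def selecting_def)
  qed
  then show "wps win_code (\<lambda>V W M N. \<exists>\<mu>. selected \<mu> V W M N) V W M N"
    by (simp add: win_code_def selected_def)
qed (simp add: win_code_def)

text \<open>
  The optimal linkage value is the value of the current set, and its argument is the next element of
  the chain; ties between candidates are broken arbitrarily by the preceding concurrent write.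
\<close>

lemma extend_hoare:
  assumes G: "\<And>i. i < n \<Longrightarrow> greedy_inv n orc k i (s i) (\<theta> i) (\<beta> i)"
  shows "hoare (selected \<mu>) (Block extend_code)
    (\<lambda>V W M N. \<exists>s \<theta> \<beta>. base (Suc k) s \<theta> \<beta> V W M \<and>
       (\<forall>i<n. greedy_inv n orc (Suc k) i (s i) (\<theta> i) (\<beta> i))) 9"
proof (rule hoare_blockI)
  fix V W M N assume r: "selected \<mu> V W M N"
  have b: "base k s \<theta> \<beta> V W M" and mark: "\<And>q. q < p \<Longrightarrow> V rMark q = n - k"
    and table: "\<And>i x. i < n \<Longrightarrow> x < n \<Longrightarrow> N (slot i x) = keyval s i x"
    and ptr: "\<And>i. i < n \<Longrightarrow> M (slot i 0 + n * n) = slot i (\<mu> i)"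
    and mu: "\<And>i. i < n \<Longrightarrow> \<mu> i < n" "\<And>i x. i < n \<Longrightarrow> x < n \<Longrightarrow> key_le s i (\<mu> i) x"
    using r by (simp_all add: selected_def)
  note env = envD[OF base_env[OF b]]
  have regs: "V rK q = k" "V rFirst q = (if k = 1 then 1 else 0)"
    "k \<noteq> 1 \<Longrightarrow> V rThr q = \<theta> (row_of q)" "k \<noteq> 1 \<Longrightarrow> W fBest q = \<beta> (row_of q)" if "q < p" for q
    using b that by (simp_all add: base_def)
  define v where "v i = keyval s i (\<mu> i)" for i
  define s' where "s' i = (s i)(\<mu> i := n - k)" for i
  define \<theta>' where "\<theta>' i = (if k = 1 \<or> \<beta> i < v i then n - k else \<theta> i)" for i
  define \<beta>' where "\<beta>' i = (if k = 1 \<or> \<beta> i < v i then v i else \<beta> i)" for i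
  have G': "greedy_inv n orc (Suc k) i (s' i) (\<theta>' i) (\<beta>' i)" if i: "i < n" for i
    unfolding \<theta>'_def \<beta>'_def
  proof (rule greedy_inv_step[OF G[OF i] k mu(1)[OF i]])
    have key_le: "\<And>y. y < n \<Longrightarrow> s i (\<mu> i) < s i y \<or> s i (\<mu> i) = s i y \<and> keyval s i (\<mu> i) \<le> keyval s i y"
      using mu(2)[OF i] by (simp add: key_le_def)
    note am = greedy_inv_argmin[OF G[OF i] k mu(1)[OF i], of "keyval s i", OF keyval_def key_le]
    show "s i (\<mu> i) = 0" by (rule am(1))
    show "v i = linkage_min {..<n} orc {y. y < n \<and> s i y \<noteq> 0}" unfolding v_def by (rule am(2))
  qed (simp_all add: v_def keyval_def s'_def)
  have addr: "M (slot (row_of q) 0 + n * n) = slot (row_of q) (\<mu> (row_of q))" "N (slot (row_of q) (\<mu> (row_of q))) = v (row_of q)"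
    if "q < p" for q using ptr table mu(1) row_of_less[OF that] by (simp_all add: v_def)
  have mem: "M' (slot i y) = s' i y"
    if o: "outcome p (\<lambda>q. M (V rPtr0 q)) (V rMark) M M'" and iy: "i < n" "y < n" for M' i y
  proof (cases "y = \<mu> i")
    case True
    obtain q where q: "q < p" "row_of q = i"
      using processor_exists[of i 0 0] iy shape_facts(3,4) by metis
    have "M' (slot i y) = n - k"
      by (rule outcome_hit[OF o q(1)]) (use True q mark env addr[OF q(1)] in simp_all)
    then show ?thesis using True by (simp add: s'_def)
  next
    case False
    have "M' (slot i y) = M (slot i y)"
    proof (rule outcome_miss[OF o])
      fix q assume q: "q < p"
      show "M (V rPtr0 q) \<noteq> slot i y"
        using False iy q env addr[OF q] mu(1)[OF row_of_less[OF q]] by auto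
    qed
    then show ?thesis using b iy False by (simp add: base_def s'_def)
  qed
  have fin: "\<exists>s \<theta> \<beta>. base (Suc k) s \<theta> \<beta> V' W' M' \<and>
       (\<forall>i<n. greedy_inv n orc (Suc k) i (s i) (\<theta> i) (\<beta> i))"
    if "outcome p (\<lambda>q. M (V rPtr0 q)) (V rMark) M M'" and "env V'"
      and "\<And>q. q < p \<Longrightarrow> V' rK q = Suc k \<and> V' rFirst q = 0 \<and> V' rThr q = \<theta>' (row_of q) \<and> W' fBest q = \<beta>' (row_of q)"
    for M' V' W'
    using that mem[OF that(1)] G' k(1)
    by (intro exI[of _ s'] exI[of _ \<theta>'] exI[of _ \<beta>']) (simp add: base_def)
  show "wps extend_code (\<lambda>V W M N. \<exists>s \<theta> \<beta>. base (Suc k) s \<theta> \<beta> V W M \<and>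
       (\<forall>i<n. greedy_inv n orc (Suc k) i (s i) (\<theta> i) (\<beta> i))) V W M N"
    apply (simp add: extend_code_def)
    apply (intro allI impI)
    apply (erule fin)
    subgoal using base_env[OF b] by simp
    subgoal for M' q using regs[of q] mark[of q] addr[of q] env[of q] by (auto simp: \<theta>'_def \<beta>'_def)
    done
qed (simp add: extend_code_def)

lemma round_hoare:
  assumes G: "\<And>i. i < n \<Longrightarrow> greedy_inv n orc k i (s i) (\<theta> i) (\<beta> i)"
  shows "hoare (\<lambda>V W M N. base k s \<theta> \<beta> V W M) round_code
    (\<lambda>V W M N. \<exists>s \<theta> \<beta>. base (Suc k) s \<theta> \<beta> V W M \<and>
       (\<forall>i<n. greedy_inv n orc (Suc k) i (s i) (\<theta> i) (\<beta> i))) (18 * len + 21 * rounds + 38)"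
proof -
  let ?C = "Block duel_code ;; Block lose_code ;; Block win_code ;; Block extend_code"
  let ?Q = "\<lambda>V W M N. \<exists>s \<theta> \<beta>. base (Suc k) s \<theta> \<beta> V W M \<and>
       (\<forall>i<n. greedy_inv n orc (Suc k) i (s i) (\<theta> i) (\<beta> i))"
  have last: "hoare (\<lambda>V W M N. \<exists>\<mu>. selected \<mu> V W M N) (Block extend_code) ?Q 9"
    by (rule hoare_ex) (rule extend_hoare[OF G])
  have "hoare (\<lambda>V W M N. \<exists>m. (winning m \<and> (\<forall>i<n. \<forall>y<a. m i y < n)) \<and> reduced m V W M N) ?C ?Q (11 + (3 + (4 + 9)))"
  proof (rule hoare_ex, rule hoare_pure)
    fix m assume "winning m \<and> (\<forall>i<n. \<forall>y<a. m i y < n)"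
    then show "hoare (reduced m) ?C ?Q (11 + (3 + (4 + 9)))"
      by (intro hoare_seq[OF duel_hoare] hoare_seq[OF lose_hoare] hoare_seq[OF win_hoare last]) auto
  qed
  then have C: "hoare (doubling (2 ^ rounds)) ?C ?Q (11 + (3 + (4 + 9)))"
  proof (rule hoare_conseq)
    fix V W M N assume "doubling (2 ^ rounds) V W M N"
    then obtain m where m: "reduced m V W M N" "covers (2 ^ rounds) m" unfolding doubling_def by blast
    have "winning m" by (rule covers_winning[OF m(2) rounds(1)]) simp
    then show "\<exists>m. (winning m \<and> (\<forall>i<n. \<forall>y<a. m i y < n)) \<and> reduced m V W M N"
      using m(1) by (auto simp: reduced_def)
  qed auto
  show ?thesis unfolding round_code_def
    by (rule hoare_mono_time, (rule hoare_seq fill_start_hoare fill_hoare publish_hoare double_hoare C)+) simp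
qed

end

definition greedy_done :: assn where
  "greedy_done V W M N \<longleftrightarrow> (\<exists>s \<theta> \<beta>. base n s \<theta> \<beta> V W M \<and>
       (\<forall>i<n. greedy_inv n orc n i (s i) (\<theta> i) (\<beta> i)))"

lemma greedy_hoare:
  "hoare greedy_start greedy_code greedy_done (n * (18 * len + 21 * rounds + 41) + 2)"
proof -
  let ?G = "\<lambda>k V W M N. \<exists>s \<theta> \<beta>. base k s \<theta> \<beta> V W M \<and>
       (\<forall>i<n. greedy_inv n orc k i (s i) (\<theta> i) (\<beta> i))"
  have "hoare (?G (Suc 0)) greedy_code (?G (Suc (n - 1))) ((n - 1) * (18 * len + 21 * rounds + 38 + 3) + 2)"
    unfolding greedy_code_def
  proof (rule hoare_while)
    fix j assume j: "j < n - 1"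
    have k: "1 \<le> Suc j" "Suc j < n" using j by auto
    show "hoare (?G (Suc j)) round_code (?G (Suc (Suc j))) (18 * len + 21 * rounds + 38)"
    proof (intro hoare_ex)
      fix s \<theta> \<beta>
      have "hoare (\<lambda>V W M N. (\<forall>i<n. greedy_inv n orc (Suc j) i (s i) (\<theta> i) (\<beta> i)) \<and> base (Suc j) s \<theta> \<beta> V W M)
         round_code (?G (Suc (Suc j))) (18 * len + 21 * rounds + 38)"
        by (rule hoare_pure) (rule round_hoare[OF k], blast)
      then show "hoare (\<lambda>V W M N. base (Suc j) s \<theta> \<beta> V W M \<and>
           (\<forall>i<n. greedy_inv n orc (Suc j) i (s i) (\<theta> i) (\<beta> i)))
         round_code (?G (Suc (Suc j))) (18 * len + 21 * rounds + 38)"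
        by (simp add: conj_commute)
    qed
  next
    fix j V W M N q assume "j < n - 1" "?G (Suc j) V W M N" "q < p"
    then show "V rK q < V rN q" by (auto simp: base_def env_def)
  next
    fix V W M N q assume "?G (Suc (n - 1)) V W M N" "q < p"
    then show "\<not> V rK q < V rN q" by (auto simp: base_def env_def)
  next
    fix j V W M N and v :: "nat \<Rightarrow> nat" assume "?G (Suc j) V W M N"
    then show "?G (Suc j) (V(3 := v)) W M N" by (simp only: base_upd simp_thms)
  qed
  then show ?thesis
  proof (rule hoare_conseq)
    fix V W M N assume g: "greedy_start V W M N"
    then have "base (Suc 0) (\<lambda>i y. M (slot i y)) (\<lambda>_. 0) (\<lambda>_. 0) V W M"
      by (simp add: greedy_start_def base_def)
    moreover have "greedy_inv n orc 1 i (\<lambda>y. M (slot i y)) 0 0" if "i < n" for i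
      by (rule greedy_inv_init[OF that]) (use g that in \<open>simp add: greedy_start_def\<close>)
    ultimately show "?G (Suc 0) V W M N"
      by (intro exI[of _ "\<lambda>i y. M (slot i y)"] exI[of _ "\<lambda>_. 0"]) simp
  next
    have "Suc (n - 1) = n" using n2 by simp
    then show "?G (Suc (n - 1)) V W M N \<Longrightarrow> greedy_done V W M N" for V W M N
      by (simp add: greedy_done_def)
  next
    have e: "18 * len + 21 * rounds + 38 + 3 = 18 * len + 21 * rounds + 41" by simp
    show "(n - 1) * (18 * len + 21 * rounds + 38 + 3) + 2 \<le> n * (18 * len + 21 * rounds + 41) + 2"
      unfolding e by (intro add_right_mono mult_le_mono1) simp
  qed
qed

end

section \<open>Listing the minimal maximizers\<close>

definition share_code :: "instr list" where
  "share_code = [StoreR rPtr0 fBest, Store rPtr0 rThr, MoveR fMax fBest,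
     Add rQ rNN rOne, Add rQ rQ rNN, Const rJ 0]"

definition max_body :: "instr list" where
  "max_body = [LoadR fV rQ, LessR rC fMax fV, CMoveR rC fMax fV, Add rQ rQ rN, Add rJ rJ rOne]"

definition check_start :: "instr list" where
  "check_start = [LessR rBad fBest fMax, Const rJ 0, Add rQ rNN rOne, Add rD rQ rI,
     Add rQ rQ rNN, Move rE rRow]"

definition check_body :: "instr list" where
  "check_body = [Load rS1 rE, Less rC rThr rS1,
     Load rS1 rD, Load rS2 rQ, Less rC1 rS2 rS1, Sub rC1 rOne rC1, Less rC2 rJ rI, Add rC1 rC1 rC2,
     Move rT rZero, CMove rC rT rC1, Add rBad rBad rT,
     Add rE rE rOne, Add rQ rQ rN, Add rD rD rN, Add rJ rJ rOne]"

definition rank_start :: "instr list" where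
  "rank_start = [Store rFlag0 rBad, Const rJ 0, Add rQ rNN rOne, Add rQ rQ rNN, Add rQ rQ rNN,
     Const rTot 0, Const rOut 1]"

definition rank_body :: "instr list" where
  "rank_body = [Load rS1 rQ, Less rC rS1 rOne, Add rTot rTot rC,
     Move rT rZero, CMove rC rT rN, Less rC1 rJ rI, Move rU rZero, CMove rC1 rU rT, Add rOut rOut rU,
     Add rQ rQ rN, Add rJ rJ rOne]"

definition write_start :: "instr list" where
  "write_start = [Const rJ 0, Move rE rRow]"

definition write_body :: "instr list" where
  "write_body = [Load rS1 rE, Less rC rThr rS1, Move rT rOut, CMove rBad rT rZero, Store rT rC,
     Add rE rE rOne, Add rOut rOut rOne, Add rJ rJ rOne]"

definition output_code :: com where
  "output_code = Block share_code ;; While rJ rN (Block max_body) ;;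
     Block check_start ;; While rJ rN (Block check_body) ;;
     Block rank_start ;; While rJ rN (Block rank_body) ;;
     Block write_start ;; While rJ rN (Block write_body) ;; Block [Store rZero rTot]"

text \<open>
  Here every loop has \<open>n\<close> iterations of constant length, and all processors of one chain do the same
  work.
\<close>

locale output_phase = layout n p orc a b len w
  for n p :: nat and orc and a b len w :: nat +
  fixes s :: "nat \<Rightarrow> nat \<Rightarrow> nat" and \<theta> :: "nat \<Rightarrow> nat" and \<beta> :: "nat \<Rightarrow> real"
  assumes best: "\<And>i. i < n \<Longrightarrow> least_best {..<n} orc i {y. y < n \<and> \<theta> i < s i y} (\<beta> i)"

sublocale output_phase \<subseteq> least_best_family n orc "\<lambda>i. {y. y < n \<and> \<theta> i < s i y}" \<beta>
  by unfold_locales (rule best)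

context output_phase
begin

declare if_weak_cong [cong del]

definition found :: "(nat \<Rightarrow> nat \<Rightarrow> nat) \<Rightarrow> (nat \<Rightarrow> nat \<Rightarrow> real) \<Rightarrow> (nat \<Rightarrow> nat) \<Rightarrow> bool" where
  "found V W M \<longleftrightarrow> env V \<and> (\<forall>q<p. V rThr q = \<theta> (row_of q) \<and> W fBest q = \<beta> (row_of q)) \<and>
     (\<forall>i<n. \<forall>y<n. M (slot i y) = s i y)"

lemma found_upd [simp]: "d = 3 \<or> 22 < d \<Longrightarrow> found (V(d := f)) W M = found V W M"
  by (auto simp: found_def)

lemma found_upd_real [simp]: "d \<noteq> 3 \<Longrightarrow> found V (W(d := f)) M = found V W M"
  by (simp add: found_def)

lemma found_mem:
  assumes "found V W M" "\<And>i y. i < n \<Longrightarrow> y < n \<Longrightarrow> M' (slot i y) = M (slot i y)"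
  shows "found V W M'"
  using assms by (simp add: found_def)

lemma foundD:
  assumes "found V W M"
  shows "env V" "q < p \<Longrightarrow> V rThr q = \<theta> (row_of q)" "q < p \<Longrightarrow> W fBest q = \<beta> (row_of q)"
    "i < n \<Longrightarrow> y < n \<Longrightarrow> M (slot i y) = s i y"
  using assms by (simp_all add: found_def)

lemma slot_row:
  "n * n + Suc 0 = slot 0 0" "Suc (n * n) = slot 0 0"
  "slot i y + n = slot (Suc i) y" "slot i y + n * n + n = slot (Suc i) y + n * n"
  "slot i y + n * n + n * n + n = slot (Suc i) y + n * n + n * n"
  "Suc (slot i y) = slot i (Suc y)" "slot 0 0 + i = slot 0 i"
  by (simp_all add: slot_def)

lemma store_column:
  assumes o: "outcome p A v M M'" and i: "i < n"
    and A: "\<And>q. q < p \<Longrightarrow> A q = slot (row_of q) 0 + c"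
    and v: "\<And>q. q < p \<Longrightarrow> v q = u (row_of q)"
  shows "M' (slot i 0 + c) = u i"
proof -
  have n0: "0 < n" using n2 by simp
  obtain q where q: "q < p" "row_of q = i"
    using processor_exists[of i 0 0] i shape_facts(3,4) by metis
  show ?thesis
  proof (rule outcome_hit[OF o q(1)])
    show "A q = slot i 0 + c" using A q by simp
    fix q' assume "q' < p" "A q' = slot i 0 + c"
    then have "row_of q' = i" using A n0 by simp
    then show "v q' = u i" using v \<open>q' < p\<close> by simp
  qed
qed

definition shared :: assn where
  "shared V W M N \<longleftrightarrow> found V W M \<and> (\<forall>i<n. M (slot i 0 + n * n) = \<theta> i \<and> N (slot i 0 + n * n) = \<beta> i)"

lemma shared_upd [simp]: "d = 3 \<or> 22 < d \<Longrightarrow> shared (V(d := f)) W M N = shared V W M N"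
  by (simp add: shared_def)

lemma shared_upd_real [simp]: "d \<noteq> 3 \<Longrightarrow> shared V (W(d := f)) M N = shared V W M N"
  by (simp add: shared_def)

definition maxing :: "nat \<Rightarrow> assn" where
  "maxing j V W M N \<longleftrightarrow> shared V W M N \<and> (\<forall>q<p. V rJ q = j \<and> V rQ q = slot j 0 + n * n \<and>
     \<beta> (row_of q) \<le> W fMax q \<and> (\<forall>i<j. \<beta> i \<le> W fMax q) \<and> (\<exists>i<n. W fMax q = \<beta> i))"

lemma share_hoare: "hoare (\<lambda>V W M N. found V W M) (Block share_code) (maxing 0) 6"
proof (rule hoare_blockI)
  fix V W M N assume f: "found V W M"
  note env = envD[OF foundD(1)[OF f]]
  have n0: "0 < n" using n2 by simp
  have mem: "shared V W M' N'"
    if oN: "outcome p (V rPtr0) (W fBest) N N'" and oM: "outcome p (V rPtr0) (V rThr) M M'" for M' N'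
  proof -
    have "found V W M'"
    proof (rule found_mem[OF f])
      fix i y assume "i < n" "y < n"
      then show "M' (slot i y) = M (slot i y)"
        by (intro outcome_miss[OF oM]) (simp add: env row_of_less n0)
    qed
    moreover have "M' (slot i 0 + n * n) = \<theta> i" "N' (slot i 0 + n * n) = \<beta> i" if i: "i < n" for i
      by (rule store_column[OF oM i], simp_all add: env foundD[OF f])
        (rule store_column[OF oN i], simp_all add: env foundD[OF f])
    ultimately show ?thesis by (simp add: shared_def)
  qed
  show "wps share_code (maxing 0) V W M N"
    using mem row_of_less by (auto simp: share_code_def maxing_def env slot_row foundD[OF f])
qed (simp add: share_code_def)

lemma max_hoare: "hoare (maxing 0) (While rJ rN (Block max_body)) (maxing n) (n * (5 + 3) + 2)"
proof (rule hoare_while)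
  fix j assume j: "j < n"
  show "hoare (maxing j) (Block max_body) (maxing (Suc j)) 5"
  proof (rule hoare_blockI)
    fix V W M N assume m: "maxing j V W M N"
    then have sh: "shared V W M N" by (simp add: maxing_def)
    then have f: "found V W M" and N: "N (slot j 0 + n * n) = \<beta> j" using j by (simp_all add: shared_def)
    note env = envD[OF foundD(1)[OF f]]
    have V: "V rJ q = j" "V rQ q = slot j 0 + n * n" "\<beta> (row_of q) \<le> W fMax q"
      "\<forall>i<j. \<beta> i \<le> W fMax q" "\<exists>i<n. W fMax q = \<beta> i" if "q < p" for q
      using m that by (simp_all add: maxing_def)
    have upd1: "\<beta> (row_of q) \<le> \<beta> j \<and> (\<forall>i<Suc j. \<beta> i \<le> \<beta> j) \<and> (\<exists>i<n. \<beta> j = \<beta> i)"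
      if "q < p" "W fMax q < \<beta> j" for q
      using V(3,4)[OF that(1)] that(2) j by (force simp: less_Suc_eq)
    have upd2: "\<beta> (row_of q) \<le> W fMax q \<and> (\<forall>i<Suc j. \<beta> i \<le> W fMax q) \<and> (\<exists>i<n. W fMax q = \<beta> i)"
      if "q < p" "\<not> W fMax q < \<beta> j" for q
      using V(3-5)[OF that(1)] that(2) by (auto simp: less_Suc_eq)
    show "wps max_body (maxing (Suc j)) V W M N"
      using sh V(1,2) by (simp add: max_body_def maxing_def env slot_row N) (use upd1 upd2 in blast)
  qed (simp add: max_body_def)
next
  fix j V W M N and v assume "maxing j V W M N"
  then show "maxing j (V(3 := v)) W M N" by (simp add: maxing_def)
next
  fix j V W M N q assume "j < n" "maxing j V W M N" "q < p"
  then show "V rJ q < V rN q" by (auto simp: maxing_def shared_def found_def env_def)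
next
  fix V W M N q assume "maxing n V W M N" "q < p"
  then show "\<not> V rJ q < V rN q" by (auto simp: maxing_def shared_def found_def env_def)
qed

text \<open>
  The representative test of \<open>rep\<close> with only the elements below \<open>j\<close> examined.
\<close>

definition checked :: "nat \<Rightarrow> nat \<Rightarrow> bool" where
  "checked j i \<longleftrightarrow> (\<forall>i'<n. \<beta> i' \<le> \<beta> i) \<and>
     (\<forall>j'<j. \<theta> i < s i j' \<longrightarrow> \<theta> j' < s j' i \<and> i \<le> j')"

lemma checked_rep: "i < n \<Longrightarrow> checked n i \<longleftrightarrow> rep i"
  by (auto simp: checked_def rep_def)

definition verifying :: "nat \<Rightarrow> assn" where
  "verifying j V W M N \<longleftrightarrow> shared V W M N \<and> (\<forall>q<p. V rJ q = j \<and> V rE q = slot (row_of q) j \<and>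
     V rQ q = slot j 0 + n * n \<and> V rD q = slot j (row_of q) \<and> (V rBad q = 0 \<longleftrightarrow> checked j (row_of q)))"

lemma check_start_hoare: "hoare (maxing n) (Block check_start) (verifying 0) 6"
proof (rule hoare_blockI)
  fix V W M N assume m: "maxing n V W M N"
  then have sh: "shared V W M N" by (simp add: maxing_def)
  then have f: "found V W M" by (simp add: shared_def)
  note env = envD[OF foundD(1)[OF f]]
  have bad: "\<not> \<beta> (row_of q) < W fMax q \<longleftrightarrow> checked 0 (row_of q)" if q: "q < p" for q
  proof -
    have V: "\<forall>i<n. \<beta> i \<le> W fMax q" "\<exists>i<n. W fMax q = \<beta> i" using m q by (simp_all add: maxing_def)
    then show ?thesis by (auto simp: checked_def intro: order_trans)
  qed
  show "wps check_start (verifying 0) V W M N"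
    using sh by (simp add: check_start_def verifying_def env slot_row foundD[OF f]) (use bad in blast)
qed (simp add: check_start_def)

lemma check_hoare: "hoare (verifying 0) (While rJ rN (Block check_body)) (verifying n) (n * (15 + 3) + 2)"
proof (rule hoare_while)
  fix j assume j: "j < n"
  show "hoare (verifying j) (Block check_body) (verifying (Suc j)) 15"
  proof (rule hoare_blockI)
    fix V W M N assume m: "verifying j V W M N"
    then have sh: "shared V W M N" by (simp add: verifying_def)
    then have f: "found V W M" and M: "M (slot j 0 + n * n) = \<theta> j" using j by (simp_all add: shared_def)
    note env = envD[OF foundD(1)[OF f]]
    have V: "V rJ q = j" "V rE q = slot (row_of q) j" "V rQ q = slot j 0 + n * n" "V rD q = slot j (row_of q)"
      "V rBad q = 0 \<longleftrightarrow> checked j (row_of q)" if "q < p" for q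
      using m that by (simp_all add: verifying_def)
    have upd: "checked (Suc j) i \<longleftrightarrow> checked j i \<and> (\<theta> i < s i j \<longrightarrow> \<theta> j < s j i \<and> \<not> j < i)" for i
      by (auto simp: checked_def less_Suc_eq)
    show "wps check_body (verifying (Suc j)) V W M N"
      using sh V j row_of_less
      by (auto simp: check_body_def verifying_def env slot_row M foundD[OF f] upd split: if_splits)
  qed (simp add: check_body_def)
next
  fix j V W M N and v assume "verifying j V W M N"
  then show "verifying j (V(3 := v)) W M N" by (simp add: verifying_def)
next
  fix j V W M N q assume "j < n" "verifying j V W M N" "q < p"
  then show "V rJ q < V rN q" by (auto simp: verifying_def shared_def found_def env_def)
next
  fix V W M N q assume "verifying n V W M N" "q < p"
  then show "\<not> V rJ q < V rN q" by (auto simp: verifying_def shared_def found_def env_def)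
qed

text \<open>
  The position in the output of the set represented by \<open>i\<close>.
\<close>

definition rank :: "nat \<Rightarrow> nat" where
  "rank i = length (filter rep [0..<i])"

lemma rank_Suc: "rank (Suc i) = rank i + (if rep i then 1 else 0)"
  by (simp add: rank_def)

lemma rank_0 [simp]: "rank 0 = 0"
  by (simp add: rank_def)

lemma rank_le: "rank i \<le> i"
  unfolding rank_def using length_filter_le[of rep "[0..<i]"] by simp

lemma rank_strict: "i < j \<Longrightarrow> rep i \<Longrightarrow> rank i < rank j"
proof (induction j)
  case (Suc j)
  then show ?case by (cases "i = j") (auto simp: rank_Suc)
qed simp

lemma rank_inj: "rep i \<Longrightarrow> rep j \<Longrightarrow> rank i = rank j \<Longrightarrow> i = j"
  using rank_strict[of i j] rank_strict[of j i] by (cases i j rule: linorder_cases) auto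

lemma nth_rank:
  assumes "i < n" "rep i"
  shows "filter rep [0..<n] ! rank i = i" "rank i < length (filter rep [0..<n])"
proof -
  have "[0..<n] = [0..<i] @ i # [Suc i..<n]"
    using assms(1) by (metis upt_conv_Cons le_add_same_cancel1 less_imp_le_nat upt_add_eq_append zero_le le_add_diff_inverse)
  then have "filter rep [0..<n] = filter rep [0..<i] @ i # filter rep [Suc i..<n]"
    using assms(2) by simp
  then show "filter rep [0..<n] ! rank i = i" "rank i < length (filter rep [0..<n])"
    by (simp_all add: rank_def)
qed

definition ranking :: "nat \<Rightarrow> assn" where
  "ranking j V W M N \<longleftrightarrow> found V W M \<and> (\<forall>i<n. M (slot i 0 + n * n + n * n) = 0 \<longleftrightarrow> rep i) \<and>
     (\<forall>q<p. V rJ q = j \<and> V rQ q = slot j 0 + n * n + n * n \<and> (V rBad q = 0 \<longleftrightarrow> rep (row_of q)) \<and>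
        V rTot q = rank j \<and> V rOut q = 1 + n * rank (min j (row_of q)))"

lemma rank_start_hoare: "hoare (verifying n) (Block rank_start) (ranking 0) 7"
proof (rule hoare_blockI)
  fix V W M N assume c: "verifying n V W M N"
  then have f: "found V W M" by (simp add: verifying_def shared_def)
  note env = envD[OF foundD(1)[OF f]]
  have n0: "0 < n" using n2 by simp
  have bad: "V rBad q = 0 \<longleftrightarrow> rep (row_of q)" if "q < p" for q
    using c that checked_rep[OF row_of_less[OF that]] by (simp add: verifying_def)
  have mem: "found V W M' \<and> (\<forall>i<n. M' (slot i 0 + n * n + n * n) = 0 \<longleftrightarrow> rep i)"
    if o: "outcome p (V rFlag0) (V rBad) M M'" for M'
  proof (intro conjI allI impI)
    show "found V W M'"
    proof (rule found_mem[OF f])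
      fix i y assume "i < n" "y < n"
      then show "M' (slot i y) = M (slot i y)"
        by (intro outcome_miss[OF o]) (simp add: env row_of_less n0)
    qed
    fix i assume i: "i < n"
    obtain q0 where q0: "q0 < p" "row_of q0 = i"
      using processor_exists[of i 0 0] i shape_facts(3,4) by metis
    then have "V rFlag0 q0 = slot i 0 + n * n + n * n" by (simp add: env)
    from outcome_some[OF o q0(1) this] obtain q where q: "q < p" "V rFlag0 q = slot i 0 + n * n + n * n"
      "M' (slot i 0 + n * n + n * n) = V rBad q" by blast
    then have "row_of q = i" using env(13)[OF q(1)] n0 by simp
    then show "M' (slot i 0 + n * n + n * n) = 0 \<longleftrightarrow> rep i" using q bad by simp
  qed
  show "wps rank_start (ranking 0) V W M N"
    using mem bad by (simp add: rank_start_def ranking_def env slot_row)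
qed (simp add: rank_start_def)

lemma rank_hoare: "hoare (ranking 0) (While rJ rN (Block rank_body)) (ranking n) (n * (11 + 3) + 2)"
proof (rule hoare_while)
  fix j assume j: "j < n"
  show "hoare (ranking j) (Block rank_body) (ranking (Suc j)) 11"
  proof (rule hoare_blockI)
    fix V W M N assume m: "ranking j V W M N"
    then have f: "found V W M" and flags: "\<forall>i<n. M (slot i 0 + n * n + n * n) = 0 \<longleftrightarrow> rep i"
      by (simp_all add: ranking_def)
    then have M: "M (slot j 0 + n * n + n * n) = 0 \<longleftrightarrow> rep j" using j by simp
    note env = envD[OF foundD(1)[OF f]]
    have V: "V rJ q = j" "V rQ q = slot j 0 + n * n + n * n" "V rBad q = 0 \<longleftrightarrow> rep (row_of q)"
      "V rTot q = rank j" "V rOut q = 1 + n * rank (min j (row_of q))" if "q < p" for q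
      using m that by (simp_all add: ranking_def)
    have upd: "rank (min (Suc j) i) = rank (min j i) + (if j < i \<and> rep j then 1 else 0)" for i
      by (cases "j < i") (simp_all add: min_def rank_Suc)
    show "wps rank_body (ranking (Suc j)) V W M N"
      using f flags V M by (auto simp: rank_body_def ranking_def env slot_row upd rank_Suc)
  qed (simp add: rank_body_def)
next
  fix j V W M N and v assume "ranking j V W M N"
  then show "ranking j (V(3 := v)) W M N" by (simp add: ranking_def)
next
  fix j V W M N q assume "j < n" "ranking j V W M N" "q < p"
  then show "V rJ q < V rN q" by (auto simp: ranking_def found_def env_def)
next
  fix V W M N q assume "ranking n V W M N" "q < p"
  then show "\<not> V rJ q < V rN q" by (auto simp: ranking_def found_def env_def)
qed

text \<open>
  Ranks are smaller than \<open>n\<close>, so the output stays within the first \<open>n * n\<close> cells after cell \<open>0\<close> and does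
  not touch the tables that are still being read.
\<close>

definition written :: "nat \<Rightarrow> (nat \<Rightarrow> nat) \<Rightarrow> bool" where
  "written j M \<longleftrightarrow> (\<forall>i<n. rep i \<longrightarrow> (\<forall>y<j. M (1 + (n * rank i + y)) = (if \<theta> i < s i y then 1 else 0)))"

definition writing :: "nat \<Rightarrow> assn" where
  "writing j V W M N \<longleftrightarrow> found V W M \<and> written j M \<and>
     (\<forall>q<p. V rJ q = j \<and> V rE q = slot (row_of q) j \<and> (V rBad q = 0 \<longleftrightarrow> rep (row_of q)) \<and>
        V rTot q = rank n \<and> V rOut q = 1 + (n * rank (row_of q) + j))"

lemma write_start_hoare: "hoare (ranking n) (Block write_start) (writing 0) 2"
proof (rule hoare_blockI)
  fix V W M N assume r: "ranking n V W M N"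
  then have f: "found V W M" by (simp add: ranking_def)
  note env = envD[OF foundD(1)[OF f]]
  have "min n (row_of q) = row_of q" if "q < p" for q using row_of_less[OF that] by simp
  then show "wps write_start (writing 0) V W M N"
    using r f by (simp add: write_start_def writing_def written_def ranking_def env)
qed (simp add: write_start_def)

lemma write_hoare: "hoare (writing 0) (While rJ rN (Block write_body)) (writing n) (n * (8 + 3) + 2)"
proof (rule hoare_while)
  fix j assume j: "j < n"
  show "hoare (writing j) (Block write_body) (writing (Suc j)) 8"
  proof (rule hoare_blockI)
    fix V W M N assume m: "writing j V W M N"
    then have f: "found V W M" and wr: "written j M" by (simp_all add: writing_def)
    note env = envD[OF foundD(1)[OF f]]
    have V: "V rJ q = j" "V rE q = slot (row_of q) j" "V rBad q = 0 \<longleftrightarrow> rep (row_of q)"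
      "V rTot q = rank n" "V rOut q = 1 + (n * rank (row_of q) + j)" if "q < p" for q
      using m that by (simp_all add: writing_def)
    let ?A = "\<lambda>q. if 0 < V rBad q then V rZero q else V rOut q"
    let ?v = "\<lambda>q. if V rThr q < M (V rE q) then Suc 0 else 0"
    have A: "?A q = (if rep (row_of q) then 1 + (n * rank (row_of q) + j) else 0)" if "q < p" for q
      using V[OF that] env(2)[OF that] by auto
    have v: "?v q = (if \<theta> (row_of q) < s (row_of q) j then 1 else 0)" if "q < p" for q
      using V(2)[OF that] foundD(2,4)[OF f] row_of_less[OF that] that j by simp
    have rk: "rank i < n" if "i < n" for i using rank_le[of i] that by simp
    have mem: "found V W M' \<and> written (Suc j) M'" if o: "outcome p ?A ?v M M'" for M'
    proof
      show "found V W M'"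
      proof (rule found_mem[OF f])
        fix i y assume iy: "i < n" "y < n"
        have "?A q \<noteq> slot i y" if "q < p" for q
        proof -
          have "?A q \<le> n * n"
            using A[OF that] grid_less[OF rk[OF row_of_less[OF that]] j] by simp
          then show ?thesis using slot_bounds(1)[of i y] by linarith
        qed
        then show "M' (slot i y) = M (slot i y)" by (rule outcome_miss[OF o])
      qed
      show "written (Suc j) M'"
        unfolding written_def
      proof (intro allI impI)
        fix i y assume i: "i < n" "rep i" and y: "y < Suc j"
        show "M' (1 + (n * rank i + y)) = (if \<theta> i < s i y then 1 else 0)"
        proof (cases "y = j")
          case True
          obtain q where q: "q < p" "row_of q = i"
            using processor_exists[of i 0 0] i shape_facts(3,4) by metis
          show ?thesis
          proof (rule outcome_hit[OF o q(1)])
            show "?A q = 1 + (n * rank i + y)" using A[OF q(1)] q i True by simp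
            fix q' assume q': "q' < p" "?A q' = 1 + (n * rank i + y)"
            then have "rep (row_of q')" "n * rank (row_of q') + j = n * rank i + j"
              using A[OF q'(1)] True by (simp_all split: if_splits)
            then have "row_of q' = i" using grid_inj[OF j j] i rank_inj by blast
            then show "?v q' = (if \<theta> i < s i y then 1 else 0)" using v[OF q'(1)] True by simp
          qed
        next
          case False
          then have yj: "y < j" using y by simp
          have "M' (1 + (n * rank i + y)) = M (1 + (n * rank i + y))"
          proof (rule outcome_miss[OF o])
            fix q assume q: "q < p"
            have "n * rank (row_of q) + j \<noteq> n * rank i + y" using grid_inj[of j y] yj j by simp
            then show "?A q \<noteq> 1 + (n * rank i + y)" using A[OF q] by simp
          qed
          then show ?thesis using wr i yj by (simp add: written_def)
        qed
      qed
    qed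
    show "wps write_body (writing (Suc j)) V W M N"
      using mem V by (simp add: write_body_def writing_def env slot_row)
  qed (simp add: write_body_def)
next
  fix j V W M N and v assume "writing j V W M N"
  then show "writing j (V(3 := v)) W M N" by (simp add: writing_def)
next
  fix j V W M N q assume "j < n" "writing j V W M N" "q < p"
  then show "V rJ q < V rN q" by (auto simp: writing_def found_def env_def)
next
  fix V W M N q assume "writing n V W M N" "q < p"
  then show "\<not> V rJ q < V rN q" by (auto simp: writing_def found_def env_def)
qed

text \<open>
  Cell \<open>0\<close> received all idle writes; only now does it get its final value.
\<close>

lemma total_hoare:
  "hoare (writing n) (Block [Store rZero rTot]) (\<lambda>V W M N. written n M \<and> M 0 = rank n) 1"
proof (rule hoare_blockI)
  fix V W M N assume m: "writing n V W M N"
  then have f: "found V W M" and wr: "written n M" and tot: "\<And>q. q < p \<Longrightarrow> V rTot q = rank n"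
    by (simp_all add: writing_def)
  note env = envD[OF foundD(1)[OF f]]
  have n0: "0 < n" using n2 by simp
  have "written n M' \<and> M' 0 = rank n" if o: "outcome p (V rZero) (V rTot) M M'" for M'
  proof
    have "M' (Suc x) = M (Suc x)" for x by (rule outcome_miss[OF o]) (simp add: env)
    then show "written n M'" using wr by (simp add: written_def)
    obtain q where q: "q < p" using processor_exists[of 0 0 0] n0 shape_facts(3,4) by metis
    show "M' 0 = rank n" by (rule outcome_hit[OF o q]) (use env q tot in simp_all)
  qed
  then show "wps [Store rZero rTot] (\<lambda>V W M N. written n M \<and> M 0 = rank n) V W M N" by simp
qed simp

lemma output_hoare:
  "hoare (\<lambda>V W M N. found V W M) output_code (\<lambda>V W M N. written n M \<and> M 0 = rank n) (51 * n + 30)"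
  unfolding output_code_def
  by (rule hoare_mono_time, (rule hoare_seq share_hoare max_hoare check_start_hoare check_hoare
     rank_start_hoare rank_hoare write_start_hoare write_hoare total_hoare)+) simp

lemma output_sets_written:
  assumes "written n M" "M 0 = rank n"
  shows "output_sets n M = map (\<lambda>i. {y. y < n \<and> \<theta> i < s i y}) (filter rep [0..<n])"
proof (rule nth_equalityI)
  show len: "length (output_sets n M) = length (map (\<lambda>i. {y. y < n \<and> \<theta> i < s i y}) (filter rep [0..<n]))"
    using assms(2) by (simp add: output_sets_def rank_def)
  fix k assume k: "k < length (output_sets n M)"
  define i where "i = filter rep [0..<n] ! k"
  have k': "k < length (filter rep [0..<n])" using k len by simp
  then have "i \<in> set (filter rep [0..<n])" unfolding i_def by (rule nth_mem)
  then have i: "i < n" "rep i" by simp_all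
  have "distinct (filter rep [0..<n])" by simp
  then have rk: "rank i = k"
    using nth_eq_iff_index_eq[OF _ nth_rank(2)[OF i] k'] nth_rank(1)[OF i] by (simp add: i_def)
  have "M (1 + k * n + y) = (if \<theta> i < s i y then 1 else 0)" if "y < n" for y
    using assms(1)[unfolded written_def, rule_format, OF i that] by (simp add: rk mult.commute)
  then have "decode_set n M (1 + k * n) = {y. y < n \<and> \<theta> i < s i y}"
    by (auto simp: decode_set_def split: if_splits)
  moreover have "output_sets n M ! k = decode_set n M (1 + k * n)"
    using k by (simp add: output_sets_def)
  ultimately show "output_sets n M ! k = map (\<lambda>i. {y. y < n \<and> \<theta> i < s i y}) (filter rep [0..<n]) ! k"
    using k' by (simp add: i_def)
qed

lemma output_correct:
  assumes "written n M" "M 0 = rank n"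
  shows "distinct (output_sets n M)" "set (output_sets n M) = minimal_maximizers {..<n} orc"
proof -
  have st: "set (filter rep [0..<n]) = {i. i < n \<and> rep i}" by auto
  show "distinct (output_sets n M)"
    using inj_on_rep unfolding output_sets_written[OF assms] distinct_map st by simp
  show "set (output_sets n M) = minimal_maximizers {..<n} orc"
    unfolding output_sets_written[OF assms] set_map st minimal_maximizers_rep ..
qed

end

definition whole_code :: com where
  "whole_code = prelude ;; greedy_code ;; output_code"

context layout
begin

lemma whole_hoare:
  assumes mono: "monotone_linkage {..<n} orc"
  shows "hoare start whole_code
    (\<lambda>V W M N. distinct (output_sets n M) \<and> set (output_sets n M) = minimal_maximizers {..<n} orc)
    (150 * (n * (len + rounds + 1)))"
proof -
  let ?Q = "\<lambda>V W M N. distinct (output_sets n M) \<and> set (output_sets n M) = minimal_maximizers {..<n} orc"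
  have out: "hoare greedy_done output_code ?Q (51 * n + 30)"
  proof (rule hoare_conseq)
    show "hoare (\<lambda>V W M N. \<exists>s \<theta> \<beta>. (\<forall>i<n. greedy_inv n orc n i (s i) (\<theta> i) (\<beta> i)) \<and> base n s \<theta> \<beta> V W M)
       output_code ?Q (51 * n + 30)"
    proof (intro hoare_ex hoare_pure)
      fix s \<theta> \<beta> assume G: "\<forall>i<n. greedy_inv n orc n i (s i) (\<theta> i) (\<beta> i)"
      interpret output_phase n p orc a b len w s \<theta> \<beta>
        by unfold_locales (use greedy_inv_least_best[OF mono n2] G in blast)
      show "hoare (\<lambda>V W M N. base n s \<theta> \<beta> V W M) output_code ?Q (51 * n + 30)"
        by (rule hoare_conseq[OF output_hoare])
          (use n2 output_correct in \<open>auto simp: base_def found_def\<close>)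
    qed
  qed (auto simp: greedy_done_def)
  have "42 * n + (n * (18 * len + 21 * rounds + 41) + 2 + (51 * n + 30)) \<le> 150 * (n * (len + rounds + 1))"
    using n2 by (simp add: algebra_simps)
  then show ?thesis unfolding whole_code_def
    by (rule hoare_mono_time[OF hoare_seq[OF prelude_hoare hoare_seq[OF greedy_hoare out]]])
qed

end

lemma finds_layout:
  fixes X :: "'a set"
  assumes X: "finite X" "card X \<ge> 2" and mono: "monotone_linkage X \<pi>" and g: "g \<ge> 1"
    and shape: "(a, b, len, w) \<in> {(1, 1, card X, 1), (card X, 1, 1, card X), (card X, card X, 1, 1)}"
    and p: "p = card X * a * b"
    and T: "g * real (150 * (card X * (len + (LEAST t. w \<le> 2 ^ t) + 1))) \<le> T"
  shows "finds_minimal_maximizers (compile 0 whole_code) p X \<pi> g T"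
  unfolding finds_minimal_maximizers_def
proof (intro allI impI, elim conjE)
  fix xs :: "'a list" and c
  let ?n = "card X" and ?f = "(!) xs"
  let ?orc = "\<lambda>i Z. \<pi> (?f i) (?f ` Z)"
  assume xs: "distinct xs" "set xs = X" and run: "is_run (compile 0 whole_code) ?n ?orc p c"
  interpret layout ?n p ?orc a b len w
    by unfold_locales (use X shape p in auto)
  have len: "?n = length xs" using distinct_card[OF xs(1)] unfolding xs(2) .
  have bij: "bij_betw ?f {..<?n} X" unfolding len by (rule bij_betw_nth[OF xs(1) refl xs(2)[symmetric]])
  have mono': "monotone_linkage {..<?n} ?orc" by (rule monotone_transfer[OF bij refl mono])
  have init: "start (\<lambda>r q. ((\<lambda>_. 0)(0 := q, 1 := ?n, 2 := p)) r) (\<lambda>_ _. 0) (\<lambda>_. 0) (\<lambda>_. 0)"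
    by (simp add: start_def)
  obtain t where t: "halted (compile 0 whole_code) p (c t)"
    "elapsed (compile 0 whole_code) p g c t \<le> g * real (150 * (?n * (len + rounds + 1)))"
    "distinct (output_sets ?n (mem (c t)))"
    "set (output_sets ?n (mem (c t))) = minimal_maximizers {..<?n} ?orc"
    using run_hoare[OF whole_hoare[OF mono'] run init g] by blast
  have sub: "S \<subseteq> {..<?n}" if "S \<in> set (output_sets ?n (mem (c t)))" for S
    using that by (auto simp: output_sets_def decode_set_def)
  have "inj_on ((`) ?f) (set (output_sets ?n (mem (c t))))"
    using bij sub by (intro inj_on_subset[OF inj_on_image_Pow]) (auto simp: bij_betw_def)
  then have "distinct (map ((`) ?f) (output_sets ?n (mem (c t))))" using t(3) by (simp add: distinct_map)
  moreover have "set (map ((`) ?f) (output_sets ?n (mem (c t)))) = minimal_maximizers X \<pi>"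
    using t(4) minimal_maximizers_transfer[OF bij refl, of \<pi>] by simp
  moreover have "elapsed (compile 0 whole_code) p g c t \<le> T"
    using t(2) T by (simp add: rounds_def)
  ultimately show "\<exists>t. halted (compile 0 whole_code) p (c t) \<and> elapsed (compile 0 whole_code) p g c t \<le> T \<and>
      (let found = map ((`) ?f) (output_sets ?n (mem (c t)))
       in distinct found \<and> set found = minimal_maximizers X \<pi>)"
    using t(1) unfolding Let_def by blast
qed

text \<open>
  One doubling fewer would leave the window smaller than \<open>n\<close>.
\<close>

lemma doubling_rounds_le:
  assumes "2 \<le> n"
  shows "real (LEAST t. n \<le> 2 ^ t) \<le> log 2 (real n) + 1"
proof (cases "LEAST t. n \<le> 2 ^ t")
  case 0
  have "0 \<le> log 2 (real n)" using assms by simp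
  then show ?thesis unfolding 0 by simp
next
  case (Suc t)
  have "\<not> n \<le> 2 ^ t" by (rule not_less_Least) (simp add: Suc)
  then have "2 ^ t < n" by simp
  then have "real t < log 2 (real n)" by (rule less_log2_of_power)
  then show ?thesis unfolding Suc by simp
qed

lemma no_doubling: "(LEAST t. (1::nat) \<le> 2 ^ t) = 0"
  by (rule Least_eq_0) simp

theorem mainTheorem2:
  shows "\<exists>prog :: instr list.
    (\<exists>C1 C2 :: real. \<forall>(X :: 'a set) (\<pi> :: 'a \<Rightarrow> 'a set \<Rightarrow> real) (g :: real).
       finite X \<and> card X \<ge> 2 \<and> monotone_linkage X \<pi> \<and> g \<ge> 1 \<longrightarrow>
       finds_minimal_maximizers prog (card X) X \<pi> g
         (C1 * (real (card X) ^ 2 * g) + C2 * log 2 (log 2 (real (card X))))) \<and>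
    (\<exists>C :: real. \<forall>(X :: 'a set) (\<pi> :: 'a \<Rightarrow> 'a set \<Rightarrow> real) (g :: real).
       finite X \<and> card X \<ge> 2 \<and> monotone_linkage X \<pi> \<and> g \<ge> 1 \<longrightarrow>
       finds_minimal_maximizers prog (card X ^ 2) X \<pi> g
         (C * (g * real (card X) * log 2 (real (card X))))) \<and>
    (\<exists>C :: real. \<forall>(X :: 'a set) (\<pi> :: 'a \<Rightarrow> 'a set \<Rightarrow> real) (g :: real).
       finite X \<and> card X \<ge> 2 \<and> monotone_linkage X \<pi> \<and> g \<ge> 1 \<longrightarrow>
       finds_minimal_maximizers prog (card X ^ 3) X \<pi> g
         (C * (g * real (card X))))"
proof (intro exI[of _ "compile 0 whole_code"] conjI)
  show "\<exists>C1 C2 :: real. \<forall>(X :: 'a set) (\<pi> :: 'a \<Rightarrow> 'a set \<Rightarrow> real) (g :: real).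
       finite X \<and> card X \<ge> 2 \<and> monotone_linkage X \<pi> \<and> g \<ge> 1 \<longrightarrow>
       finds_minimal_maximizers (compile 0 whole_code) (card X) X \<pi> g
         (C1 * (real (card X) ^ 2 * g) + C2 * log 2 (log 2 (real (card X))))"
  proof (rule exI[of _ 300], rule exI[of _ 0], intro allI impI, elim conjE)
    fix X :: "'a set" and \<pi> :: "'a \<Rightarrow> 'a set \<Rightarrow> real" and g :: real
    assume X: "finite X" "card X \<ge> 2" "monotone_linkage X \<pi>" "g \<ge> 1"
    let ?n = "card X"
    have "150 * (?n * (?n + 0 + 1)) \<le> 300 * ?n ^ 2"
      using X(2) by (simp add: power2_eq_square algebra_simps)
    then have "real (150 * (?n * (?n + 0 + 1))) \<le> real (300 * ?n ^ 2)" by (simp only: of_nat_le_iff)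
    then have "g * real (150 * (?n * (?n + 0 + 1))) \<le> g * real (300 * ?n ^ 2)"
      using X(4) by (intro mult_left_mono) auto
    then show "finds_minimal_maximizers (compile 0 whole_code) ?n X \<pi> g
         (300 * (real ?n ^ 2 * g) + 0 * log 2 (log 2 (real ?n)))"
      by (intro finds_layout[OF X, of 1 1 ?n 1]) (simp_all add: no_doubling[simplified] mult_ac)
  qed
  show "\<exists>C :: real. \<forall>(X :: 'a set) (\<pi> :: 'a \<Rightarrow> 'a set \<Rightarrow> real) (g :: real).
       finite X \<and> card X \<ge> 2 \<and> monotone_linkage X \<pi> \<and> g \<ge> 1 \<longrightarrow>
       finds_minimal_maximizers (compile 0 whole_code) (card X ^ 2) X \<pi> g
         (C * (g * real (card X) * log 2 (real (card X))))"
  proof (intro exI[of _ 600] allI impI, elim conjE)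
    fix X :: "'a set" and \<pi> :: "'a \<Rightarrow> 'a set \<Rightarrow> real" and g :: real
    assume X: "finite X" "card X \<ge> 2" "monotone_linkage X \<pi>" "g \<ge> 1"
    let ?n = "card X"
    define R where "R = (LEAST t. ?n \<le> 2 ^ t)"
    have "1 \<le> log 2 (real ?n)" using X(2) by (simp add: le_log_iff)
    then have "real (1 + R + 1) \<le> 4 * log 2 (real ?n)"
      using doubling_rounds_le[OF X(2)] by (simp add: R_def)
    then have "g * (150 * real ?n) * real (1 + R + 1) \<le> g * (150 * real ?n) * (4 * log 2 (real ?n))"
      using X(4) by (intro mult_left_mono) auto
    then have "g * real (150 * (?n * (1 + R + 1))) \<le> 600 * (g * real ?n * log 2 (real ?n))"
      by (simp only: of_nat_mult of_nat_numeral mult_ac)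
    then show "finds_minimal_maximizers (compile 0 whole_code) (?n ^ 2) X \<pi> g
         (600 * (g * real ?n * log 2 (real ?n)))"
      by (intro finds_layout[OF X, of ?n 1 1 ?n]) (simp_all add: R_def power2_eq_square)
  qed
  show "\<exists>C :: real. \<forall>(X :: 'a set) (\<pi> :: 'a \<Rightarrow> 'a set \<Rightarrow> real) (g :: real).
       finite X \<and> card X \<ge> 2 \<and> monotone_linkage X \<pi> \<and> g \<ge> 1 \<longrightarrow>
       finds_minimal_maximizers (compile 0 whole_code) (card X ^ 3) X \<pi> g
         (C * (g * real (card X)))"
  proof (intro exI[of _ 300] allI impI, elim conjE)
    fix X :: "'a set" and \<pi> :: "'a \<Rightarrow> 'a set \<Rightarrow> real" and g :: real
    assume X: "finite X" "card X \<ge> 2" "monotone_linkage X \<pi>" "g \<ge> 1"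
    let ?n = "card X"
    show "finds_minimal_maximizers (compile 0 whole_code) (?n ^ 3) X \<pi> g (300 * (g * real ?n))"
      by (intro finds_layout[OF X, of ?n ?n 1 1])
        (simp_all add: no_doubling[simplified] power3_eq_cube)
  qed
qed

end
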